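(* Let $X,Y,Z$ be Banach spaces, and let $A\in\mathcal{B}(X)$, $B\in\mathcal{B}(Y)$, $C\in\mathcal{B}(Z)$. Assume that $B$ is regular. For $D\in\mathcal{B}(Y,X)$, $E\in\mathcal{B}(Z,X)$, $F\in\mathcal{B}(Z,Y)$ let $$M_{D,E,F}=\begin{pmatrix}A & D & E\\ 0 & B & F\\ 0 & 0 & C\end{pmatrix}\in\mathcal{B}(X\oplus Y\oplus Z).$$ Consider the following statements. 1) All of the following hold: (a) $A$ is left invertible and $C$ is right invertible; (b) $\mathcal{N}(B)\preceq X/\mathcal{R}(A)$ and $Y/\mathcal{R}(B)\preceq\mathcal{N}(C)$; (c) there exist left invertible operators $J_1:\mathcal{N}(B)\to X/\mathcal{R}(A)$ and $J_2:Y/\mathcal{R}(B)\to\mathcal{N}(C)$ (realizing the relations $\preceq$ in (b)) such that $$\frac{X/\mathcal{R}(A)}{\mathcal{R}(J_1)}\cong\frac{\mathcal{N}(C)}{\mathcal{R}(J_2)}.$$ 2) There exist $D\in\mathcal{B}(Y,X)$, $E\in\mathcal{B}(Z,X)$, $F\in\mathcal{B}(Z,Y)$ such that $M_{D,E,F}$ is invertible. 3) All of the following hold: (a) $A$ is left invertible and $C$ is right invertible; (b) $\mathcal{N}(B)\preceq X/\mathcal{R}(A)$ and $Y/\mathcal{R}(B)\preceq\mathcal{N}(C)$; (c) $\mathcal{N}(B)\times\mathcal{N}(C)\cong X/\mathcal{R}(A)\times Y/\mathcal{R}(B)$. Then $1)\Rightarrow 2)\Rightarrow 3)$.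
   Context: $\mathcal{B}(X,Y)$ is the set of bounded linear operators from $X$ to $Y$, and $\mathcal{B}(X)=\mathcal{B}(X,X)$. $\mathcal{N}(T)$ and $\mathcal{R}(T)$ denote the null space and range of $T$. An operator $T\in\mathcal{B}(X,Y)$ is (inner) regular if there is $T'\in\mathcal{B}(Y,X)$ with $T=TT'T$; equivalently, $\mathcal{N}(T)$ and $\mathcal{R}(T)$ are closed and complemented subspaces. $T$ is left invertible if $\mathcal{N}(T)=\{0\}$ and $\mathcal{R}(T)$ is closed and complemented; $T$ is right invertible if $T$ is surjective and $\mathcal{N}(T)$ is complemented; $T$ is invertible if it is bijective. For Banach spaces $U,V$, $U\preceq V$ means that there exists a left invertible operator in $\mathcal{B}(U,V)$, and $U\cong V$ means that $U$ and $V$ are isomorphic as Banach spaces (there is an invertible operator in $\mathcal{B}(U,V)$). For a closed subspace $U$ of $V$, $\frac{V}{U}$ denotes the quotient space $V/U$. *)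

theory Defs
  imports "HOL-Analysis.Analysis"
begin

text \<open>
  The null spaces and the (iterated) quotients in the theorem depend on the operators, so they
  cannot be types. Normed spaces are therefore given by an explicit carrier and explicit
  operations. The scalars form a \<^class>\<open>real_normed_field\<close>; up to isomorphism these
  are exactly the real and the complex numbers, so both cases are covered.
\<close>

record ('k, 'a) nspace =
  carr :: "'a set"
  vadd :: "'a \<Rightarrow> 'a \<Rightarrow> 'a"
  vzero :: "'a"
  vscale :: "'k \<Rightarrow> 'a \<Rightarrow> 'a"
  vnorm :: "'a \<Rightarrow> real"

text \<open>
  A type of class \<^class>\<open>banach\<close> together with such an \<open>s\<close> is a Banach space
  over \<open>'k\<close>. For real scalars \<open>s\<close> has to be \<^const>\<open>scaleR\<close>, and for complex
  scalars this is a complex Banach space.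
\<close>

definition banach_scaling :: "('k::real_normed_field \<Rightarrow> 'a::banach \<Rightarrow> 'a) \<Rightarrow> bool" where
  "banach_scaling s \<longleftrightarrow>
     vector_space s \<and>
     (\<forall>r x. s (of_real r) x = r *\<^sub>R x) \<and>
     (\<forall>a x. norm (s a x) = norm a * norm x)"

definition whole_space :: "('k::real_normed_field \<Rightarrow> 'a::banach \<Rightarrow> 'a) \<Rightarrow> ('k, 'a) nspace" where
  "whole_space s = \<lparr>carr = UNIV, vadd = (+), vzero = 0, vscale = s, vnorm = norm\<rparr>"

definition sub_space :: "('k, 'a) nspace \<Rightarrow> 'a set \<Rightarrow> ('k, 'a) nspace" where
  "sub_space V U = V\<lparr>carr := U\<rparr>"

definition coset :: "('k, 'a) nspace \<Rightarrow> 'a set \<Rightarrow> 'a \<Rightarrow> 'a set" where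
  "coset V U x = {vadd V x u | u. u \<in> U}"

text \<open>
  In the scalar multiplication, adding \<open>U\<close> matters only for the scalar \<open>0\<close>, where
  \<open>{0 x | x. x \<in> S}\<close> is not a coset.
\<close>

definition quotient_space :: "('k, 'a) nspace \<Rightarrow> 'a set \<Rightarrow> ('k, 'a set) nspace" where
  "quotient_space V U =
     \<lparr>carr = coset V U ` carr V,
      vadd = (\<lambda>S T. {vadd V x y | x y. x \<in> S \<and> y \<in> T}),
      vzero = coset V U (vzero V),
      vscale = (\<lambda>a S. {vadd V (vscale V a x) u | x u. x \<in> S \<and> u \<in> U}),
      vnorm = (\<lambda>S. INF x\<in>S. vnorm V x)\<rparr>"

text \<open>The norm is the library's norm on product types (here \<^typ>\<open>real \<times> real\<close>).\<close>

definition prod_space :: "('k, 'a) nspace \<Rightarrow> ('k, 'b) nspace \<Rightarrow> ('k, 'a \<times> 'b) nspace" where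
  "prod_space V W =
     \<lparr>carr = carr V \<times> carr W,
      vadd = (\<lambda>p q. (vadd V (fst p) (fst q), vadd W (snd p) (snd q))),
      vzero = (vzero V, vzero W),
      vscale = (\<lambda>a p. (vscale V a (fst p), vscale W a (snd p))),
      vnorm = (\<lambda>p. norm (vnorm V (fst p), vnorm W (snd p)))\<rparr>"

text \<open>The value off the carrier is chosen so that \<^locale>\<open>Metric_space\<close> can be instantiated.\<close>

definition vdist :: "('k::real_normed_field, 'a) nspace \<Rightarrow> 'a \<Rightarrow> 'a \<Rightarrow> real" where
  "vdist V x y =
     (if x \<in> carr V \<and> y \<in> carr V then vnorm V (vadd V x (vscale V (- 1) y)) else 0)"

definition closed_subspace :: "('k::real_normed_field, 'a) nspace \<Rightarrow> 'a set \<Rightarrow> bool" where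
  "closed_subspace V U \<longleftrightarrow>
     U \<subseteq> carr V \<and> vzero V \<in> U \<and>
     (\<forall>x\<in>U. \<forall>y\<in>U. vadd V x y \<in> U) \<and>
     (\<forall>a. \<forall>x\<in>U. vscale V a x \<in> U) \<and>
     closedin (Metric_space.mtopology (carr V) (vdist V)) U"

definition closed_complemented :: "('k::real_normed_field, 'a) nspace \<Rightarrow> 'a set \<Rightarrow> bool" where
  "closed_complemented V U \<longleftrightarrow>
     closed_subspace V U \<and>
     (\<exists>W. closed_subspace V W \<and> U \<inter> W = {vzero V} \<and>
          {vadd V u w | u w. u \<in> U \<and> w \<in> W} = carr V)"

text \<open>The values of an operator outside the carrier of its domain are irrelevant.\<close>

definition bounded_ops ::
    "('k::real_normed_field, 'a) nspace \<Rightarrow> ('k, 'b) nspace \<Rightarrow> ('a \<Rightarrow> 'b) set" where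
  "bounded_ops V W =
     {T. T ` carr V \<subseteq> carr W \<and>
         (\<forall>x\<in>carr V. \<forall>y\<in>carr V. T (vadd V x y) = vadd W (T x) (T y)) \<and>
         (\<forall>a. \<forall>x\<in>carr V. T (vscale V a x) = vscale W a (T x)) \<and>
         (\<exists>K. \<forall>x\<in>carr V. vnorm W (T x) \<le> K * vnorm V x)}"

definition null_set :: "('k, 'a) nspace \<Rightarrow> ('k, 'b) nspace \<Rightarrow> ('a \<Rightarrow> 'b) \<Rightarrow> 'a set" where
  "null_set V W T = {x \<in> carr V. T x = vzero W}"

definition range_set :: "('k, 'a) nspace \<Rightarrow> ('a \<Rightarrow> 'b) \<Rightarrow> 'b set" where
  "range_set V T = T ` carr V"

definition regular_op ::
    "('k::real_normed_field, 'a) nspace \<Rightarrow> ('k, 'b) nspace \<Rightarrow> ('a \<Rightarrow> 'b) \<Rightarrow> bool" where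
  "regular_op V W T \<longleftrightarrow>
     T \<in> bounded_ops V W \<and>
     (\<exists>T'\<in>bounded_ops W V. \<forall>x\<in>carr V. T x = T (T' (T x)))"

definition left_invertible_op ::
    "('k::real_normed_field, 'a) nspace \<Rightarrow> ('k, 'b) nspace \<Rightarrow> ('a \<Rightarrow> 'b) \<Rightarrow> bool" where
  "left_invertible_op V W T \<longleftrightarrow>
     T \<in> bounded_ops V W \<and> null_set V W T = {vzero V} \<and>
     closed_complemented W (range_set V T)"

definition right_invertible_op ::
    "('k::real_normed_field, 'a) nspace \<Rightarrow> ('k, 'b) nspace \<Rightarrow> ('a \<Rightarrow> 'b) \<Rightarrow> bool" where
  "right_invertible_op V W T \<longleftrightarrow>
     T \<in> bounded_ops V W \<and> range_set V T = carr W \<and>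
     closed_complemented V (null_set V W T)"

definition invertible_op ::
    "('k::real_normed_field, 'a) nspace \<Rightarrow> ('k, 'b) nspace \<Rightarrow> ('a \<Rightarrow> 'b) \<Rightarrow> bool" where
  "invertible_op V W T \<longleftrightarrow> T \<in> bounded_ops V W \<and> bij_betw T (carr V) (carr W)"

definition embeds :: "('k::real_normed_field, 'a) nspace \<Rightarrow> ('k, 'b) nspace \<Rightarrow> bool"
    (infix "\<preceq>\<^sub>B" 50) where
  "V \<preceq>\<^sub>B W \<longleftrightarrow> (\<exists>T. left_invertible_op V W T)"

definition isomorphic_spaces :: "('k::real_normed_field, 'a) nspace \<Rightarrow> ('k, 'b) nspace \<Rightarrow> bool"
    (infix "\<cong>\<^sub>B" 50) where
  "V \<cong>\<^sub>B W \<longleftrightarrow> (\<exists>T. invertible_op V W T)"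

definition upper_triangular ::
    "('x::plus \<Rightarrow> 'x) \<Rightarrow> ('y::plus \<Rightarrow> 'y) \<Rightarrow> ('z \<Rightarrow> 'z) \<Rightarrow>
     ('y \<Rightarrow> 'x) \<Rightarrow> ('z \<Rightarrow> 'x) \<Rightarrow> ('z \<Rightarrow> 'y) \<Rightarrow> 'x \<times> 'y \<times> 'z \<Rightarrow> 'x \<times> 'y \<times> 'z" where
  "upper_triangular A B C D E F = (\<lambda>(x, y, z). (A x + D y + E z, B y + F z, C z))"

lemma banach_scaling_real_iff:
  fixes s :: "real \<Rightarrow> 'a::banach \<Rightarrow> 'a"
  shows "banach_scaling s \<longleftrightarrow> s = scaleR"
proof
  show "banach_scaling s \<Longrightarrow> s = scaleR"
    by (auto simp: banach_scaling_def fun_eq_iff)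
  have "vector_space (scaleR :: real \<Rightarrow> 'a \<Rightarrow> 'a)"
    by unfold_locales
  then show "s = scaleR \<Longrightarrow> banach_scaling s"
    by (simp add: banach_scaling_def)
qed

lemma bounded_ops_whole_space_real:
  "bounded_ops (whole_space scaleR) (whole_space scaleR) = {T. bounded_linear T}"
proof -
  have "bounded_linear T \<longleftrightarrow>
      (\<forall>x y. T (x + y) = T x + T y) \<and> (\<forall>a x. T (a *\<^sub>R x) = a *\<^sub>R T x) \<and>
      (\<exists>K. \<forall>x. norm (T x) \<le> K * norm x)" for T :: "'a \<Rightarrow> 'b"
    by (auto simp: bounded_linear_def bounded_linear_axioms_def linear_iff mult.commute)
  then show ?thesis
    by (auto simp: bounded_ops_def whole_space_def)
qed

lemma vdist_whole_space:
  assumes "banach_scaling s"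
  shows "vdist (whole_space s) = dist"
proof -
  have "s (- 1) x = - x" for x
  proof -
    have "s (of_real (- 1)) x = (- 1) *\<^sub>R x"
      using assms unfolding banach_scaling_def by blast
    then show ?thesis by simp
  qed
  then show ?thesis
    by (simp add: fun_eq_iff vdist_def whole_space_def dist_norm)
qed

lemma closedin_whole_space:
  assumes "banach_scaling s"
  shows "closedin (Metric_space.mtopology (carr (whole_space s)) (vdist (whole_space s))) U
         \<longleftrightarrow> closed U"
proof -
  have "carr (whole_space s) = UNIV"
    by (simp add: whole_space_def)
  then show ?thesis
    by (simp add: vdist_whole_space[OF assms] mtopology_is_euclidean)
qed

end

theory Submission
  imports Defs
begin

text \<open>
  The implication from (2) to (3) reads everything off the blocks of \<open>N = M\<^sup>-\<^sup>1\<close>, which is bounded by the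
  open mapping theorem: \<open>y \<mapsto> D y + R(A)\<close> embeds \<open>N(B)\<close>, the block \<open>N\<^sub>3\<^sub>2\<close> composed with the projection
  \<open>I - B B'\<close> embeds \<open>Y/R(B)\<close>, and
  \<open>(y, z) \<mapsto> (D (y - B' F z) + E z + R(A), F z + R(B))\<close> is the isomorphism in (3)(c).

  For the implication from (1) to (2), the range of \<open>A\<close>, the null spaces of \<open>B\<close> and \<open>C\<close> and the range
  of \<open>B\<close> are all complemented, so that \<open>J\<^sub>1\<close>, a left inverse of \<open>J\<^sub>2\<close> and the inverse of the given
  isomorphism of the quotients can be extended to operators \<open>D\<close>, \<open>F\<close> and \<open>E\<close> between the whole spaces.
  Up to isomorphism, \<open>X = R(A) \<oplus> N(B) \<oplus> X\<^sub>1\<close> and \<open>N(C) = Y/R(B) \<oplus> X\<^sub>1\<close>, where \<open>D\<close>, \<open>F\<close> and \<open>E\<close> match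
  the summands \<open>N(B)\<close>, \<open>Y/R(B)\<close> and \<open>X\<^sub>1\<close> with their copies in \<open>Y\<close> and \<open>Z\<close>; hence \<open>M\<close> is bijective.

  All null spaces and (iterated) quotients that occur are retracts of \<open>X\<close>, \<open>Y\<close> or \<open>Z\<close>, that is, they are
  isomorphic to closed subspaces. So the open mapping theorem is needed only for closed subspaces,
  and no completeness of quotients enters.
\<close>

section \<open>The open mapping theorem on closed subspaces\<close>

text \<open>Successive approximation: solving approximately for the current residual at least halves
  it, so the corrections are dominated by a geometric series with sum
  \<open>2 * c * norm (f x)\<close>. Completeness and closedness of \<open>S\<close> give a limit in
  \<open>S\<close> with image \<open>f x\<close>, and injectivity makes this limit
  \<open>x\<close>.\<close>

lemma bounded_below_on_of_approx:
  fixes f :: "'a::banach \<Rightarrow> 'b::real_normed_vector"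
  assumes f: "bounded_linear f" and S: "subspace S" "closed S"
    and inj: "inj_on f S" and c: "0 \<le> c"
    and approx: "\<And>y. y \<in> f ` S \<Longrightarrow> \<exists>x\<in>S. norm x \<le> c * norm y \<and> norm (y - f x) \<le> norm y / 2"
  shows "\<forall>x\<in>S. norm x \<le> 2 * c * norm (f x)"
proof
  fix x assume x: "x \<in> S"
  interpret bounded_linear f by fact
  obtain h where h: "\<And>y. y \<in> f ` S \<Longrightarrow> h y \<in> S \<and> norm (h y) \<le> c * norm y \<and> norm (y - f (h y)) \<le> norm y / 2"
    using approx by metis
  \<comment> \<open>\<open>r n\<close> is what remains of \<open>f x\<close> after the images of the
    first n corrections \<open>h (r i)\<close> have been subtracted.\<close>
  define r where "r n = ((\<lambda>y. y - f (h y)) ^^ n) (f x)" for n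
  have r0: "r 0 = f x" and rS: "r (Suc n) = r n - f (h (r n))" for n
    by (simp_all add: r_def)
  have r: "r n \<in> f ` S" for n
  proof (induction n)
    case (Suc n)
    then obtain u where u: "u \<in> S" "r n = f u" by blast
    then have "r (Suc n) = f (u - h (r n))" "u - h (r n) \<in> S"
      using h[OF Suc] S(1) by (auto simp: rS diff subspace_diff)
    then show ?case by blast
  qed (use x r0 in auto)
  have rn: "norm (r n) \<le> norm (f x) * (1/2) ^ n" for n
  proof (induction n)
    case (Suc n)
    have "norm (r (Suc n)) \<le> norm (r n) / 2" using h[OF r] by (simp add: rS)
    with Suc show ?case by simp
  qed (simp add: r0)
  have hn: "norm (h (r n)) \<le> c * norm (f x) * (1/2) ^ n" for n
    using h[OF r, of n] mult_left_mono[OF rn[of n] c] by (simp add: mult.assoc)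
  have sm: "summable (\<lambda>n. norm (h (r n)))"
  proof (rule summable_comparison_test')
    show "summable (\<lambda>n. c * norm (f x) * (1/2) ^ n)"
      by (intro summable_mult summable_geometric) simp
    show "norm (norm (h (r n))) \<le> c * norm (f x) * (1/2) ^ n" for n using hn by simp
  qed
  define u where "u = (\<Sum>n. h (r n))"
  have su: "(\<lambda>n. h (r n)) sums u"
    unfolding u_def by (rule summable_sums[OF summable_norm_cancel[OF sm]])
  have partial: "(\<Sum>i<n. h (r i)) \<in> S" for n
    using h[OF r] by (intro subspace_sum[OF S(1)]) auto
  have uS: "u \<in> S"
    using closed_sequentially[OF S(2), of "\<lambda>n. \<Sum>i<n. h (r i)", OF partial] su unfolding sums_def by blast
  have "f (\<Sum>i<n. h (r i)) = f x - r n" for n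
    by (induction n) (auto simp: r0 rS add)
  moreover have "r \<longlonglongrightarrow> 0"
  proof (rule Lim_null_comparison)
    show "\<forall>\<^sub>F n in sequentially. norm (r n) \<le> norm (f x) * (1/2) ^ n" using rn by simp
    show "(\<lambda>n. norm (f x) * (1/2) ^ n) \<longlonglongrightarrow> 0"
      by (intro tendsto_mult_right_zero LIMSEQ_power_zero) simp
  qed
  ultimately have "(\<lambda>n. f (\<Sum>i<n. h (r i))) \<longlonglongrightarrow> f x"
    using tendsto_diff[of "\<lambda>_. f x" "f x" sequentially r 0] by simp
  moreover have "(\<lambda>n. f (\<Sum>i<n. h (r i))) \<longlonglongrightarrow> f u"
    using tendsto su unfolding sums_def by blast
  ultimately have "f u = f x" by (rule LIMSEQ_unique[rotated])
  then have "x = u" using inj uS x by (auto dest: inj_onD)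
  also have "norm u \<le> (\<Sum>n. c * norm (f x) * (1/2) ^ n)"
    unfolding u_def
    by (intro order_trans[OF summable_norm[OF sm]] suminf_le hn sm summable_mult summable_geometric) auto
  also have "\<dots> = 2 * c * norm (f x)"
    by (subst suminf_mult) (auto simp: suminf_geometric summable_geometric)
  finally show "norm x \<le> 2 * c * norm (f x)" .
qed

text \<open>Baire's theorem in the image of \<open>S\<close>: the closures of the images of balls of
  integer radius cover it, so one of them contains a relatively open ball. Differences move this
  ball to the origin, and scaling then reaches every y.\<close>

lemma approx_solution_of_closed_range:
  fixes f :: "'a::banach \<Rightarrow> 'b::banach"
  assumes f: "bounded_linear f" and S: "subspace S" and T: "closed (f ` S)"
  shows "\<exists>c\<ge>0. \<forall>y\<in>f ` S. \<exists>x\<in>S. norm x \<le> c * norm y \<and> norm (y - f x) \<le> norm y / 2"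
proof -
  interpret bounded_linear f by fact
  let ?T = "f ` S"
  let ?B = "\<lambda>n::nat. f ` (S \<inter> cball 0 (real n))"
  have subT: "subspace ?T"
    by (rule linear_subspace_image[OF linear S])
  have subB: "closure (?B n) \<subseteq> ?T" for n
    by (rule closure_minimal[OF _ T]) auto
  have cover: "(\<Union>n. closure (?B n)) = ?T"
  proof (intro equalityI subsetI)
    fix y assume "y \<in> ?T"
    then obtain x where x: "x \<in> S" "y = f x" by blast
    obtain n where "norm x \<le> real n" using real_arch_simple by blast
    then have "y \<in> ?B n" unfolding x(2) by (intro imageI) (simp add: x(1))
    then have "y \<in> closure (?B n)" by (rule subsetD[OF closure_subset])
    then show "y \<in> (\<Union>n. closure (?B n))" by (rule UN_I[OF UNIV_I])
  next
    fix y assume "y \<in> (\<Union>n. closure (?B n))"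
    then show "y \<in> ?T" by (rule UN_E) (rule subsetD[OF subB])
  qed
  \<comment> \<open>A closed subset of a Banach space is completely metrizable, which is the form of
    completeness that \<open>Baire_category_alt\<close> takes.\<close>
  have cm: "completely_metrizable_space (top_of_set ?T)"
    by (intro completely_metrizable_space_closedin completely_metrizable_space_euclidean) (use T in auto)
  have "\<exists>n. top_of_set ?T interior_of closure (?B n) \<noteq> {}"
  proof (rule ccontr)
    assume "\<not> ?thesis"
    then have "top_of_set ?T interior_of \<Union> (range (\<lambda>n. closure (?B n))) = {}"
      using subB by (intro Baire_category_alt disjI1 cm) (auto simp: closed_subset)
    moreover have "top_of_set ?T interior_of ?T = ?T"
      by (metis interior_of_topspace topspace_euclidean_subtopology)
    ultimately show False using cover subspace_0[OF subT] by simp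
  qed
  then obtain n y0 where y0: "y0 \<in> top_of_set ?T interior_of closure (?B n)" by blast
  then obtain G where "openin (top_of_set ?T) G" "y0 \<in> G" "G \<subseteq> closure (?B n)"
    by (auto simp: interior_of_def)
  then obtain e where e: "e > 0" "ball y0 e \<inter> ?T \<subseteq> closure (?B n)" and y0T: "y0 \<in> ?T"
    unfolding openin_contains_ball by (metis subset_eq subset_trans)
  \<comment> \<open>Here y is the difference of y0 + y and y0, which both lie in the closure. Each
    is approximated with error d / 2 by the image of a vector of norm at most n, hence the radius 2
    * n.\<close>
  have near: "\<exists>x\<in>S. norm x \<le> 2 * real n \<and> norm (y - f x) < d" if y: "y \<in> ?T" "norm y < e" and d: "d > 0" for y d
  proof -
    have appr: "\<exists>x\<in>S. norm x \<le> real n \<and> dist (f x) v < d/2" if v: "v \<in> closure (?B n)" for v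
    proof -
      obtain w where w: "w \<in> ?B n" "dist w v < d/2"
        using v half_gt_zero[OF d] unfolding closure_approachable by meson
      from w(1) obtain x where "x \<in> S" "x \<in> cball 0 (real n)" "w = f x" by blast
      with w(2) show ?thesis by (intro bexI[of _ x]) simp_all
    qed
    have "y0 + y \<in> ball y0 e" "y0 \<in> ball y0 e"
      using y(2) e(1) by (simp_all add: dist_norm)
    then have "y0 + y \<in> closure (?B n)" "y0 \<in> closure (?B n)"
      using e(2) subspace_add[OF subT y0T y(1)] y0T by (meson IntI subsetD)+
    from appr[OF this(1)] appr[OF this(2)]
    obtain u v where u: "u \<in> S" "norm u \<le> real n" "dist (f u) (y0 + y) < d/2"
      and v: "v \<in> S" "norm v \<le> real n" "dist (f v) y0 < d/2" by blast
    have "norm (y - f (u - v)) = norm ((f v - y0) - (f u - (y0 + y)))" by (simp add: diff algebra_simps)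
    also have "\<dots> < d" using norm_triangle_ineq4[of "f v - y0" "f u - (y0 + y)"] u v by (simp add: dist_norm)
    finally have "norm (y - f (u - v)) < d" .
    moreover have "norm (u - v) \<le> 2 * real n" using norm_triangle_ineq4[of u v] u v by simp
    ultimately show ?thesis using subspace_diff[OF S] u v by blast
  qed
  have "\<exists>x\<in>S. norm x \<le> (4 * real n / e) * norm y \<and> norm (y - f x) \<le> norm y / 2" if y: "y \<in> ?T" for y
  proof (cases "y = 0")
    case True
    then show ?thesis using subspace_0[OF S] by (intro bexI[of _ 0]) (auto simp: zero)
  next
    case False
    \<comment> \<open>This factor brings y to norm e / 2, within the reach of \<open>near\<close>.
      Dividing by t afterwards turns the tolerance t * norm y / 2 into norm y / 2 and the radius 2 *
      n into (4 * n / e) * norm y.\<close>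
    define t where "t = e / (2 * norm y)"
    have t: "t > 0" using False e(1) by (simp add: t_def)
    have "t *\<^sub>R y \<in> ?T" by (rule subspace_scale[OF subT y])
    moreover have "norm (t *\<^sub>R y) < e" using False e(1) by (simp add: t_def)
    moreover have "t * norm y / 2 > 0" using t False by simp
    ultimately obtain x where x: "x \<in> S" "norm x \<le> 2 * real n" "norm (t *\<^sub>R y - f x) < t * norm y / 2"
      using near by meson
    let ?x = "x /\<^sub>R t"
    have "norm ?x = norm x / t" using t by (simp add: divide_inverse mult.commute)
    also have "\<dots> \<le> 2 * real n / t" using x t by (simp add: divide_right_mono)
    also have "\<dots> = (4 * real n / e) * norm y" using e(1) False by (simp add: t_def field_simps)
    finally have 1: "norm ?x \<le> (4 * real n / e) * norm y" .
    have "y - f ?x = (t *\<^sub>R y - f x) /\<^sub>R t" using t by (simp add: scaleR scaleR_diff_right)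
    then have "norm (y - f ?x) = norm (t *\<^sub>R y - f x) / t" using t by (simp add: divide_inverse mult.commute)
    also have "\<dots> \<le> norm y / 2" using x t by (simp add: field_simps)
    finally show ?thesis using 1 subspace_scale[OF S x(1)] by blast
  qed
  then show ?thesis using e(1) by (intro exI[of _ "4 * real n / e"]) auto
qed

text \<open>The bounded inverse theorem, put as a lower bound so that it speaks of sets and not of
  types for \<open>S\<close> and its image.\<close>

lemma bounded_below_on_closed_range:
  fixes f :: "'a::banach \<Rightarrow> 'b::banach"
  assumes "bounded_linear f" "subspace S" "closed S" "inj_on f S" "closed (f ` S)"
  shows "\<exists>K\<ge>0. \<forall>x\<in>S. norm x \<le> K * norm (f x)"
proof -
  obtain c where c: "c \<ge> 0"
    and approx: "\<And>y. y \<in> f ` S \<Longrightarrow> \<exists>x\<in>S. norm x \<le> c * norm y \<and> norm (y - f x) \<le> norm y / 2"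
    using approx_solution_of_closed_range[OF assms(1,2,5)] by blast
  show ?thesis
    using bounded_below_on_of_approx[OF assms(1-4) c approx] c by (intro exI[of _ "2 * c"]) auto
qed

section \<open>Normed spaces with explicit carriers\<close>

text \<open>The record carries no laws, so they are imposed here on the carrier. Homogeneity of the
  norm is an inequality, the form in which the quotient norm delivers it; nonnegativity and the
  value at zero are derived.\<close>

locale normed_nspace =
  fixes V :: "('k::real_normed_field, 'a) nspace"
  assumes zero_closed: "vzero V \<in> carr V"
    and add_closed: "\<lbrakk>x \<in> carr V; y \<in> carr V\<rbrakk> \<Longrightarrow> vadd V x y \<in> carr V"
    and scale_closed: "x \<in> carr V \<Longrightarrow> vscale V a x \<in> carr V"
    and add_assoc: "\<lbrakk>x \<in> carr V; y \<in> carr V; z \<in> carr V\<rbrakk> \<Longrightarrow>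
      vadd V (vadd V x y) z = vadd V x (vadd V y z)"
    and add_commute: "\<lbrakk>x \<in> carr V; y \<in> carr V\<rbrakk> \<Longrightarrow> vadd V x y = vadd V y x"
    and add_zero_left: "x \<in> carr V \<Longrightarrow> vadd V (vzero V) x = x"
    and add_neg: "x \<in> carr V \<Longrightarrow> vadd V x (vscale V (- 1) x) = vzero V"
    and scale_add: "\<lbrakk>x \<in> carr V; y \<in> carr V\<rbrakk> \<Longrightarrow>
      vscale V a (vadd V x y) = vadd V (vscale V a x) (vscale V a y)"
    and add_scale: "x \<in> carr V \<Longrightarrow> vscale V (a + b) x = vadd V (vscale V a x) (vscale V b x)"
    and scale_scale: "x \<in> carr V \<Longrightarrow> vscale V a (vscale V b x) = vscale V (a * b) x"
    and scale_one: "x \<in> carr V \<Longrightarrow> vscale V 1 x = x"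
    and norm_triangle: "\<lbrakk>x \<in> carr V; y \<in> carr V\<rbrakk> \<Longrightarrow> vnorm V (vadd V x y) \<le> vnorm V x + vnorm V y"
    and norm_scale_le: "x \<in> carr V \<Longrightarrow> vnorm V (vscale V a x) \<le> norm a * vnorm V x"
    and norm_eq_zero: "\<lbrakk>x \<in> carr V; vnorm V x = 0\<rbrakk> \<Longrightarrow> x = vzero V"
begin

abbreviation vsub :: "'a \<Rightarrow> 'a \<Rightarrow> 'a" where
  "vsub x y \<equiv> vadd V x (vscale V (- 1) y)"

lemmas closed = zero_closed add_closed scale_closed

lemma add_left_commute:
  "\<lbrakk>x \<in> carr V; y \<in> carr V; z \<in> carr V\<rbrakk> \<Longrightarrow> vadd V x (vadd V y z) = vadd V y (vadd V x z)"
  by (metis add_assoc add_commute)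

lemmas ac = add_assoc add_commute add_left_commute

lemma add_zero_right: "x \<in> carr V \<Longrightarrow> vadd V x (vzero V) = x"
  using add_commute add_zero_left zero_closed by metis

lemma scale_zero_left: "x \<in> carr V \<Longrightarrow> vscale V 0 x = vzero V"
  using add_scale[of x 1 "- 1"] add_neg[of x] by (simp add: scale_one)

lemma scale_zero_right: "vscale V a (vzero V) = vzero V"
  by (metis mult_zero_right scale_scale scale_zero_left zero_closed)

lemma norm_zero: "vnorm V (vzero V) \<le> 0"
  using norm_scale_le[OF zero_closed, of 0] by (simp add: scale_zero_left zero_closed)

text \<open>Twice the norm of \<open>x\<close> bounds the norm of zero, since \<open>x\<close> and
  its negative add up to zero; the norm of zero is nonnegative because zero plus zero is
  zero.\<close>

lemma norm_nonneg: "x \<in> carr V \<Longrightarrow> 0 \<le> vnorm V x"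
proof -
  assume x: "x \<in> carr V"
  have z: "0 \<le> vnorm V (vzero V)"
    using norm_triangle[OF zero_closed zero_closed] by (simp add: add_zero_left zero_closed)
  have "vnorm V (vzero V) \<le> vnorm V x + vnorm V (vscale V (- 1) x)"
    using norm_triangle[of x "vscale V (- 1) x"] x by (simp add: add_neg scale_closed)
  also have "\<dots> \<le> 2 * vnorm V x" using norm_scale_le[OF x, of "- 1"] by simp
  finally show ?thesis using z by simp
qed

lemma norm_zero_eq: "vnorm V (vzero V) = 0"
  using norm_zero norm_nonneg[OF zero_closed] by simp

lemma neg_neg: "x \<in> carr V \<Longrightarrow> vscale V (- 1) (vscale V (- 1) x) = x"
  by (simp add: scale_scale scale_one)

lemma norm_minus: "x \<in> carr V \<Longrightarrow> vnorm V (vscale V (- 1) x) = vnorm V x"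
  using norm_scale_le[of x "- 1"] norm_scale_le[of "vscale V (- 1) x" "- 1"]
  by (simp add: scale_closed neg_neg)

lemma sub_add: "\<lbrakk>x \<in> carr V; y \<in> carr V\<rbrakk> \<Longrightarrow> vadd V (vsub x y) y = x"
  by (metis add_assoc add_commute add_neg add_zero_right scale_closed)

lemma add_sub: "\<lbrakk>x \<in> carr V; y \<in> carr V\<rbrakk> \<Longrightarrow> vsub (vadd V x y) y = x"
  by (metis add_assoc add_neg add_zero_right scale_closed)

lemma sub_eq_zero: "\<lbrakk>x \<in> carr V; y \<in> carr V\<rbrakk> \<Longrightarrow> vsub x y = vzero V \<longleftrightarrow> x = y"
  by (metis add_neg add_zero_left sub_add)

lemma sub_zero: "x \<in> carr V \<Longrightarrow> vsub x (vzero V) = x"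
  by (simp add: scale_zero_right add_zero_right)

lemma neg_sub: "\<lbrakk>x \<in> carr V; y \<in> carr V\<rbrakk> \<Longrightarrow> vscale V (- 1) (vsub x y) = vsub y x"
  by (simp add: scale_add closed neg_neg add_commute)

lemma sub_trans:
  assumes "x \<in> carr V" "y \<in> carr V" "z \<in> carr V"
  shows "vadd V (vsub x y) (vsub y z) = vsub x z"
  using assms by (metis add_assoc add_closed scale_closed sub_add)

lemma sub_add_add:
  assumes "x \<in> carr V" "y \<in> carr V" "z \<in> carr V" "w \<in> carr V"
  shows "vsub (vadd V x y) (vadd V z w) = vadd V (vsub x z) (vsub y w)"
  using assms by (simp add: scale_add closed ac)

lemma scale_sub:
  assumes "x \<in> carr V" "y \<in> carr V"
  shows "vscale V a (vsub x y) = vsub (vscale V a x) (vscale V a y)"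
  using assms by (simp add: scale_add closed scale_scale)

lemma Metric_space_vdist: "Metric_space (carr V) (vdist V)"
proof
  show "0 \<le> vdist V x y" for x y
    by (simp add: vdist_def norm_nonneg closed)
  show "vdist V x y = vdist V y x" for x y
    using neg_sub[of x y] norm_minus[of "vsub x y"] by (auto simp: vdist_def closed)
  show "vdist V x y = 0 \<longleftrightarrow> x = y" if "x \<in> carr V" "y \<in> carr V" for x y
    using that norm_eq_zero[of "vsub x y"] sub_eq_zero[of x y] norm_zero_eq
    by (auto simp: vdist_def closed)
  show "vdist V x z \<le> vdist V x y + vdist V y z"
    if "x \<in> carr V" "y \<in> carr V" "z \<in> carr V" for x y z
    using that norm_triangle[of "vsub x y" "vsub y z"] by (simp add: vdist_def closed sub_trans)
qed

text \<open>Translates the topology into distances: outside points keep a positive distance from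
  \<open>U\<close>. Closedness of preimages and definiteness of the quotient norm are proved from
  this form.\<close>

lemma closedin_iff:
  "closedin (Metric_space.mtopology (carr V) (vdist V)) U \<longleftrightarrow>
     U \<subseteq> carr V \<and> (\<forall>x \<in> carr V - U. \<exists>r>0. \<forall>u\<in>U. r \<le> vnorm V (vsub x u))"
proof -
  interpret M: Metric_space "carr V" "vdist V" by (rule Metric_space_vdist)
  have "disjnt U (M.mball x r) \<longleftrightarrow> (\<forall>u\<in>U. r \<le> vnorm V (vsub x u))"
    if "U \<subseteq> carr V" "x \<in> carr V" for x r
    using that by (auto simp: disjnt_iff vdist_def subset_iff not_less)
  then show ?thesis by (auto simp: M.closedin_metric)
qed

lemma closed_subspace_iff:
  "closed_subspace V U \<longleftrightarrow>
     U \<subseteq> carr V \<and> vzero V \<in> U \<and> (\<forall>x\<in>U. \<forall>y\<in>U. vadd V x y \<in> U) \<and>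
     (\<forall>a. \<forall>x\<in>U. vscale V a x \<in> U) \<and>
     (\<forall>x \<in> carr V - U. \<exists>r>0. \<forall>u\<in>U. r \<le> vnorm V (vsub x u))"
  unfolding closed_subspace_def closedin_iff by blast

lemma closed_subspace_zero: "closed_subspace V {vzero V}"
proof -
  have "0 < vnorm V x" if "x \<in> carr V" "x \<noteq> vzero V" for x
    using that norm_eq_zero[of x] norm_nonneg[of x] by fastforce
  then show ?thesis
    by (auto simp: closed_subspace_iff closed add_zero_left add_zero_right scale_zero_right)
qed

lemma closed_subspace_carr: "closed_subspace V (carr V)"
  by (auto simp: closed_subspace_iff closed)

lemma closed_complemented_carr: "closed_complemented V (carr V)"
  unfolding closed_complemented_def
  using closed_subspace_zero closed_subspace_carr zero_closed
  by (intro conjI exI[of _ "{vzero V}"]) (auto simp: add_zero_right, metis add_zero_right)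

lemma normed_nspace_sub_space:
  assumes U: "closed_subspace V U"
  shows "normed_nspace (sub_space V U)"
proof -
  have *: "U \<subseteq> carr V" "vzero V \<in> U" "\<And>x y. x \<in> U \<Longrightarrow> y \<in> U \<Longrightarrow> vadd V x y \<in> U"
    "\<And>a x. x \<in> U \<Longrightarrow> vscale V a x \<in> U"
    using U by (auto simp: closed_subspace_def)
  show ?thesis
    by unfold_locales
      (use * in \<open>auto simp: sub_space_def subset_iff add_neg add_zero_left scale_scale scale_one
        add_scale scale_add norm_triangle norm_scale_le norm_eq_zero add_assoc intro: add_commute\<close>)
qed

end

section \<open>Bounded operators, preimages of closed subspaces, and composition\<close>

lemma bounded_opsD:
  assumes "T \<in> bounded_ops V W"
  shows "x \<in> carr V \<Longrightarrow> T x \<in> carr W"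
    and "\<lbrakk>x \<in> carr V; y \<in> carr V\<rbrakk> \<Longrightarrow> T (vadd V x y) = vadd W (T x) (T y)"
    and "x \<in> carr V \<Longrightarrow> T (vscale V a x) = vscale W a (T x)"
  using assms by (auto simp: bounded_ops_def)

lemma bounded_ops_sub_space_iff:
  "T \<in> bounded_ops V (sub_space W U) \<longleftrightarrow>
     T ` carr V \<subseteq> U \<and> T \<in> bounded_ops V W" if "U \<subseteq> carr W"
  using that by (auto simp: bounded_ops_def sub_space_def)

lemma bounded_ops_restrict:
  "\<lbrakk>T \<in> bounded_ops V W; U \<subseteq> carr V\<rbrakk> \<Longrightarrow> T \<in> bounded_ops (sub_space V U) W"
  unfolding bounded_ops_def sub_space_def by (simp add: image_subset_iff) (meson subsetD)

lemma bounded_ops_id: "(\<lambda>x. x) \<in> bounded_ops V V"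
  by (auto simp: bounded_ops_def intro: exI[of _ 1])

locale normed_nspace_pair = V: normed_nspace V + W: normed_nspace W
  for V :: "('k::real_normed_field, 'a) nspace" and W :: "('k, 'b) nspace"
begin

lemma op_zero: "T \<in> bounded_ops V W \<Longrightarrow> T (vzero V) = vzero W"
  using bounded_opsD(1,3)[of T V W "vzero V"] V.scale_zero_left[OF V.zero_closed] V.zero_closed
    W.scale_zero_left by metis

text \<open>A constant as in \<open>bounded_ops\<close> may be zero or negative; passing to
  \<open>max K 1\<close> gives one by which later estimates can divide.\<close>

lemma op_bound:
  assumes "T \<in> bounded_ops V W"
  obtains K where "K > 0" "\<And>x. x \<in> carr V \<Longrightarrow> vnorm W (T x) \<le> K * vnorm V x"
proof -
  obtain K where K: "\<And>x. x \<in> carr V \<Longrightarrow> vnorm W (T x) \<le> K * vnorm V x"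
    using assms unfolding bounded_ops_def by blast
  have "vnorm W (T x) \<le> max K 1 * vnorm V x" if "x \<in> carr V" for x
    using K[OF that] V.norm_nonneg[OF that] by (meson max.cobounded1 mult_right_mono order_trans)
  then show ?thesis using that[of "max K 1"] by simp
qed

lemma bounded_opsI:
  assumes "\<And>x. x \<in> carr V \<Longrightarrow> T x \<in> carr W"
    and "\<And>x y. \<lbrakk>x \<in> carr V; y \<in> carr V\<rbrakk> \<Longrightarrow> T (vadd V x y) = vadd W (T x) (T y)"
    and "\<And>a x. x \<in> carr V \<Longrightarrow> T (vscale V a x) = vscale W a (T x)"
    and "\<And>x. x \<in> carr V \<Longrightarrow> vnorm W (T x) \<le> K * vnorm V x"
  shows "T \<in> bounded_ops V W"
  unfolding bounded_ops_def using assms by blast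

lemma bounded_ops_diff:
  assumes S: "S \<in> bounded_ops V W" and T: "T \<in> bounded_ops V W"
  shows "(\<lambda>x. W.vsub (S x) (T x)) \<in> bounded_ops V W"
proof -
  obtain K where K: "\<And>x. x \<in> carr V \<Longrightarrow> vnorm W (S x) \<le> K * vnorm V x" using op_bound[OF S] by blast
  obtain L where L: "\<And>x. x \<in> carr V \<Longrightarrow> vnorm W (T x) \<le> L * vnorm V x" using op_bound[OF T] by blast
  note [simp] = bounded_opsD[OF S] bounded_opsD[OF T]
  show ?thesis
  proof (rule bounded_opsI[where K = "K + L"])
    fix x assume x: "x \<in> carr V"
    show "vnorm W (W.vsub (S x) (T x)) \<le> (K + L) * vnorm V x"
      using W.norm_triangle[of "S x" "vscale W (- 1) (T x)"] K[OF x] L[OF x] x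
      by (simp add: W.closed W.norm_minus distrib_right)
  qed (simp_all add: W.closed W.sub_add_add W.scale_sub)
qed

text \<open>If \<open>T x\<close> has distance at least r from \<open>G\<close> and K bounds
  \<open>T\<close>, then x has distance at least r / K from the preimage.\<close>

lemma closed_subspace_vimage:
  assumes T: "T \<in> bounded_ops V W" and G: "closed_subspace W G"
  shows "closed_subspace V {x \<in> carr V. T x \<in> G}"
proof -
  obtain K where K: "K > 0" "\<And>x. x \<in> carr V \<Longrightarrow> vnorm W (T x) \<le> K * vnorm V x"
    using op_bound[OF T] by blast
  note D = bounded_opsD[OF T]
  have "\<exists>r>0. \<forall>u. u \<in> carr V \<and> T u \<in> G \<longrightarrow> r \<le> vnorm V (V.vsub x u)"
    if x: "x \<in> carr V" "T x \<notin> G" for x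
  proof -
    obtain r where r: "r > 0" "\<And>g. g \<in> G \<Longrightarrow> r \<le> vnorm W (W.vsub (T x) g)"
      using G D(1)[OF x(1)] x(2) unfolding W.closed_subspace_iff by (meson DiffI)
    have "r / K \<le> vnorm V (V.vsub x u)" if u: "u \<in> carr V" "T u \<in> G" for u
    proof -
      have "r \<le> vnorm W (T (V.vsub x u))" using r(2)[OF u(2)] x u by (simp add: D V.closed)
      also have "\<dots> \<le> K * vnorm V (V.vsub x u)" using x u by (intro K) (simp add: V.closed)
      finally show ?thesis using K(1) by (simp add: field_simps)
    qed
    then show ?thesis using r(1) K(1) by (intro exI[of _ "r / K"]) simp
  qed
  moreover have "vzero W \<in> G" "\<And>x y. x \<in> G \<Longrightarrow> y \<in> G \<Longrightarrow> vadd W x y \<in> G"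
    "\<And>a x. x \<in> G \<Longrightarrow> vscale W a x \<in> G"
    using G by (auto simp: closed_subspace_def)
  ultimately show ?thesis
    unfolding V.closed_subspace_iff by (auto simp: V.closed D op_zero[OF T])
qed

lemma closed_subspace_null_set:
  assumes "T \<in> bounded_ops V W"
  shows "closed_subspace V (null_set V W T)"
  using closed_subspace_vimage[OF assms W.closed_subspace_zero] by (simp add: null_set_def)

end

lemma bounded_ops_compose:
  assumes "normed_nspace U" "normed_nspace V" "normed_nspace W"
    and S: "S \<in> bounded_ops U V" and T: "T \<in> bounded_ops V W"
  shows "(\<lambda>x. T (S x)) \<in> bounded_ops U W"
proof -
  interpret UV: normed_nspace_pair U V using assms by (simp add: normed_nspace_pair_def)
  interpret VW: normed_nspace_pair V W using assms by (simp add: normed_nspace_pair_def)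
  interpret UW: normed_nspace_pair U W ..
  obtain K where K: "K > 0" "\<And>x. x \<in> carr U \<Longrightarrow> vnorm V (S x) \<le> K * vnorm U x"
    using UV.op_bound[OF S] by blast
  obtain L where L: "L > 0" "\<And>x. x \<in> carr V \<Longrightarrow> vnorm W (T x) \<le> L * vnorm V x"
    using VW.op_bound[OF T] by blast
  note [simp] = bounded_opsD[OF S] bounded_opsD[OF T]
  show ?thesis
  proof (rule UW.bounded_opsI[where K = "L * K"])
    fix x assume x: "x \<in> carr U"
    have "vnorm W (T (S x)) \<le> L * vnorm V (S x)" using x by (simp add: L)
    also have "\<dots> \<le> L * (K * vnorm U x)" using K(2)[OF x] L(1) by simp
    finally show "vnorm W (T (S x)) \<le> L * K * vnorm U x" by (simp add: mult.assoc)
  qed simp_all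
qed

section \<open>Projections, complemented subspaces and one-sided inverses\<close>

context normed_nspace
begin

text \<open>The fixed points of \<open>P\<close> form the null space of the bounded operator I -
  P.\<close>

lemma closed_subspace_fixed:
  assumes P: "P \<in> bounded_ops V V"
  shows "closed_subspace V {x \<in> carr V. P x = x}"
proof -
  interpret p: normed_nspace_pair V V ..
  have "{x \<in> carr V. P x = x} = null_set V V (\<lambda>x. vsub x (P x))"
    using bounded_opsD(1)[OF P] by (auto simp: null_set_def sub_eq_zero)
  then show ?thesis
    using p.closed_subspace_null_set[OF p.bounded_ops_diff[OF bounded_ops_id P]] by simp
qed

text \<open>The range of an idempotent is its set of fixed points, so range and null space are both
  closed; the splitting x = P x + (x - P x) makes each a complement of the other.\<close>

lemma closed_complemented_projection:
  assumes P: "P \<in> bounded_ops V V" and idem: "\<And>x. x \<in> carr V \<Longrightarrow> P (P x) = P x"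
  shows "closed_complemented V (range_set V P)" "closed_complemented V (null_set V V P)"
proof -
  interpret p: normed_nspace_pair V V ..
  note D = bounded_opsD[OF P]
  have R: "range_set V P = {x \<in> carr V. P x = x}"
    using idem D(1) by (auto simp: range_set_def image_iff) metis
  have cR: "closed_subspace V (range_set V P)"
    unfolding R by (rule closed_subspace_fixed[OF P])
  have cN: "closed_subspace V (null_set V V P)"
    by (rule p.closed_subspace_null_set[OF P])
  have I: "range_set V P \<inter> null_set V V P = {vzero V}"
    unfolding R null_set_def by (auto simp: zero_closed p.op_zero[OF P])
  have N: "vsub x (P x) \<in> null_set V V P" if "x \<in> carr V" for x
    using that D(1) by (simp add: null_set_def D closed idem add_neg)
  have sum: "x \<in> {vadd V u w | u w. u \<in> range_set V P \<and> w \<in> null_set V V P}"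
    "x \<in> {vadd V u w | u w. u \<in> null_set V V P \<and> w \<in> range_set V P}" if x: "x \<in> carr V" for x
  proof -
    have "x = vadd V (vsub x (P x)) (P x)" "x = vadd V (P x) (vsub x (P x))"
      using x D(1)[OF x] by (simp_all add: sub_add add_commute[of "P x"] closed)
    moreover have "P x \<in> range_set V P" using x by (auto simp: range_set_def)
    ultimately show "x \<in> {vadd V u w | u w. u \<in> range_set V P \<and> w \<in> null_set V V P}"
      "x \<in> {vadd V u w | u w. u \<in> null_set V V P \<and> w \<in> range_set V P}" using N[OF x] by blast+
  qed
  have sub: "range_set V P \<subseteq> carr V" "null_set V V P \<subseteq> carr V" unfolding R null_set_def by auto
  have S: "{vadd V u w | u w. u \<in> range_set V P \<and> w \<in> null_set V V P} = carr V"
    "{vadd V u w | u w. u \<in> null_set V V P \<and> w \<in> range_set V P} = carr V"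
    using sum sub add_closed by blast+
  show "closed_complemented V (range_set V P)"
    unfolding closed_complemented_def using cR cN I S(1) by blast
  have I': "null_set V V P \<inter> range_set V P = {vzero V}" using I by blast
  show "closed_complemented V (null_set V V P)"
    unfolding closed_complemented_def using cR cN I' S(2) by blast
qed

end

context normed_nspace_pair
begin

text \<open>J L is a bounded projection with the same range as \<open>J\<close>.\<close>

lemma left_invertible_opI:
  assumes J: "J \<in> bounded_ops V W" and L: "L \<in> bounded_ops W V"
    and LJ: "\<And>x. x \<in> carr V \<Longrightarrow> L (J x) = x"
  shows "left_invertible_op V W J"
proof -
  interpret WV: normed_nspace_pair W V ..
  interpret WW: normed_nspace_pair W W ..
  let ?P = "\<lambda>y. J (L y)"
  have P: "?P \<in> bounded_ops W W"
    by (rule bounded_ops_compose[OF W.normed_nspace_axioms V.normed_nspace_axioms W.normed_nspace_axioms L J])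
  have "range_set V J = range_set W ?P"
    unfolding range_set_def
  proof (intro equalityI subsetI)
    fix y assume "y \<in> J ` carr V"
    then obtain x where "x \<in> carr V" "y = J x" by blast
    then show "y \<in> ?P ` carr W" using LJ[of x] bounded_opsD(1)[OF J] by (metis image_eqI)
  qed (use bounded_opsD(1)[OF L] in auto)
  moreover have "closed_complemented W (range_set W ?P)"
    by (rule W.closed_complemented_projection(1)[OF P]) (simp add: LJ bounded_opsD(1)[OF L])
  moreover have "null_set V W J = {vzero V}"
  proof -
    have "x = vzero V" if "x \<in> carr V" "J x = vzero W" for x
      using LJ[OF that(1)] that(2) WV.op_zero[OF L] by simp
    then show ?thesis unfolding null_set_def using op_zero[OF J] V.zero_closed by blast
  qed
  ultimately show ?thesis using J by (simp add: left_invertible_op_def)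
qed

text \<open>R T is a bounded projection, and its null space is that of \<open>T\<close> because
  \<open>R\<close> is injective.\<close>

lemma right_invertible_opI:
  assumes T: "T \<in> bounded_ops V W" and R: "R \<in> bounded_ops W V"
    and TR: "\<And>y. y \<in> carr W \<Longrightarrow> T (R y) = y"
  shows "right_invertible_op V W T"
proof -
  interpret WV: normed_nspace_pair W V ..
  let ?P = "\<lambda>x. R (T x)"
  have P: "?P \<in> bounded_ops V V"
    by (rule bounded_ops_compose[OF V.normed_nspace_axioms W.normed_nspace_axioms V.normed_nspace_axioms T R])
  have "null_set V W T = null_set V V ?P"
    unfolding null_set_def
  proof (intro Collect_cong conj_cong refl)
    fix x assume "x \<in> carr V"
    then have "T (R (T x)) = T x" by (simp add: TR bounded_opsD(1)[OF T])
    then show "T x = vzero W \<longleftrightarrow> R (T x) = vzero V" using op_zero[OF T] WV.op_zero[OF R] by auto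
  qed
  moreover have "closed_complemented V (null_set V V ?P)"
    by (rule V.closed_complemented_projection(2)[OF P]) (simp add: TR bounded_opsD(1)[OF T])
  moreover have "range_set V T = carr W"
    unfolding range_set_def
  proof (intro equalityI subsetI)
    fix y assume "y \<in> carr W"
    then show "y \<in> T ` carr V" using TR[of y] bounded_opsD(1)[OF R] by (metis image_eqI)
  qed (use bounded_opsD(1)[OF T] in auto)
  ultimately show ?thesis using T by (simp add: right_invertible_op_def)
qed

end

section \<open>Quotient spaces\<close>

lemma (in normed_nspace) closed_subspace_Int:
  "closed_subspace V U \<Longrightarrow> closed_subspace V U' \<Longrightarrow> closed_subspace V (U \<inter> U')"
proof -
  interpret M: Metric_space "carr V" "vdist V" by (rule Metric_space_vdist)
  show "closed_subspace V U \<Longrightarrow> closed_subspace V U' \<Longrightarrow> closed_subspace V (U \<inter> U')"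
    unfolding closed_subspace_def by (simp add: closedin_Int le_infI1)
qed

locale nspace_quotient = normed_nspace V
  for V :: "('k::real_normed_field, 'a) nspace" +
  fixes U :: "'a set"
  assumes closed_subspace: "closed_subspace V U"
begin

abbreviation "Q \<equiv> quotient_space V U"

lemma subspace:
  "u \<in> U \<Longrightarrow> u \<in> carr V" "vzero V \<in> U" "\<lbrakk>u \<in> U; v \<in> U\<rbrakk> \<Longrightarrow> vadd V u v \<in> U"
  "u \<in> U \<Longrightarrow> vscale V a u \<in> U"
  using closed_subspace by (auto simp: closed_subspace_def)

text \<open>Expressing membership through differences turns identities between cosets into closure
  properties of \<open>U\<close>.\<close>

lemma mem_coset:
  assumes x: "x \<in> carr V"
  shows "z \<in> coset V U x \<longleftrightarrow> z \<in> carr V \<and> vsub z x \<in> U"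
proof
  assume "z \<in> coset V U x"
  then obtain u where u: "u \<in> U" "z = vadd V x u" by (auto simp: coset_def)
  have "vsub z x = u"
    using add_sub[of u x] u subspace(1) x by (simp add: add_commute[of x u])
  then show "z \<in> carr V \<and> vsub z x \<in> U" using u x subspace(1) by (simp add: closed)
next
  assume z: "z \<in> carr V \<and> vsub z x \<in> U"
  then have "z = vadd V x (vsub z x)" using x sub_add[of z x] by (simp add: add_commute[of x] closed)
  with z show "z \<in> coset V U x" unfolding coset_def by blast
qed

lemma self_mem_coset: "x \<in> carr V \<Longrightarrow> x \<in> coset V U x"
  by (simp add: mem_coset add_neg subspace)

lemma coset_eq_iff:
  assumes x: "x \<in> carr V" and y: "y \<in> carr V"
  shows "coset V U x = coset V U y \<longleftrightarrow> vsub x y \<in> U"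
proof
  assume "coset V U x = coset V U y"
  then show "vsub x y \<in> U" using self_mem_coset[OF x] mem_coset[OF y] by simp
next
  assume xy: "vsub x y \<in> U"
  then have yx: "vsub y x \<in> U" using subspace(4)[OF xy, of "- 1"] neg_sub[OF x y] by simp
  have "vsub z x \<in> U \<longleftrightarrow> vsub z y \<in> U" if z: "z \<in> carr V" for z
    using subspace(3)[of "vsub z x" "vsub x y"] subspace(3)[of "vsub z y" "vsub y x"] xy yx
      sub_trans[OF z x y] sub_trans[OF z y x] by auto
  then show "coset V U x = coset V U y" by (auto simp: mem_coset x y)
qed

lemma coset_eq_zero_iff: "x \<in> carr V \<Longrightarrow> coset V U x = vzero Q \<longleftrightarrow> x \<in> U"
  by (simp add: quotient_space_def coset_eq_iff zero_closed sub_zero)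

lemma carr_quotient: "carr Q = coset V U ` carr V"
  by (simp add: quotient_space_def)

lemma quotient_add:
  assumes x: "x \<in> carr V" and y: "y \<in> carr V"
  shows "vadd Q (coset V U x) (coset V U y) = coset V U (vadd V x y)"
proof (intro equalityI subsetI)
  fix z assume "z \<in> vadd Q (coset V U x) (coset V U y)"
  then obtain a b where "a \<in> coset V U x" "b \<in> coset V U y" "z = vadd V a b"
    by (auto simp: quotient_space_def)
  then show "z \<in> coset V U (vadd V x y)"
    using x y by (simp add: mem_coset closed sub_add_add subspace)
next
  fix z assume z: "z \<in> coset V U (vadd V x y)"
  then have zc: "z \<in> carr V" and zU: "vsub z (vadd V x y) \<in> U" using x y by (simp_all add: mem_coset closed)
  \<comment> \<open>The whole deviation of z from x + y goes into the second summand, which leaves x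
    itself as the first.\<close>
  have "z = vadd V x (vadd V y (vsub z (vadd V x y)))"
    using sub_add[of z "vadd V x y"] x y zc
    by (metis add_assoc add_closed add_commute scale_closed)
  moreover have "vadd V y (vsub z (vadd V x y)) \<in> coset V U y"
    using zU unfolding coset_def by blast
  ultimately show "z \<in> vadd Q (coset V U x) (coset V U y)"
    using self_mem_coset[OF x] by (auto simp: quotient_space_def)
qed

lemma quotient_scale:
  assumes x: "x \<in> carr V"
  shows "vscale Q a (coset V U x) = coset V U (vscale V a x)"
proof (intro equalityI subsetI)
  fix z assume "z \<in> vscale Q a (coset V U x)"
  then obtain y u where y: "y \<in> coset V U x" "u \<in> U" "z = vadd V (vscale V a y) u"
    by (auto simp: quotient_space_def)
  then obtain v where "v \<in> U" "y = vadd V x v" by (auto simp: coset_def)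
  with y have "z = vadd V (vscale V a x) (vadd V (vscale V a v) u)" "vadd V (vscale V a v) u \<in> U"
    using x subspace by (simp_all add: scale_add add_assoc closed)
  then show "z \<in> coset V U (vscale V a x)" unfolding coset_def by blast
next
  fix z assume "z \<in> coset V U (vscale V a x)"
  then show "z \<in> vscale Q a (coset V U x)"
    using self_mem_coset[OF x] by (auto simp: quotient_space_def coset_def)
qed

text \<open>This and \<open>le_quotient_norm\<close> are the two halves of the infimum; the later
  estimates of the quotient norm go through them.\<close>

lemma quotient_norm_le:
  assumes "x \<in> carr V" "z \<in> coset V U x"
  shows "vnorm Q (coset V U x) \<le> vnorm V z"
proof -
  have "bdd_below (vnorm V ` coset V U x)"
    using assms(1) by (intro bdd_belowI[of _ 0]) (auto simp: mem_coset norm_nonneg)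
  then show ?thesis using assms(2) by (simp add: quotient_space_def cINF_lower)
qed

lemma le_quotient_norm:
  assumes "x \<in> carr V" "\<And>z. z \<in> coset V U x \<Longrightarrow> c \<le> vnorm V z"
  shows "c \<le> vnorm Q (coset V U x)"
  using self_mem_coset[OF assms(1)] assms(2) by (auto simp: quotient_space_def intro!: cINF_greatest)

text \<open>The estimate holds for every pair of representatives, and the infimum is then taken over
  one of them at a time.\<close>

lemma quotient_norm_triangle:
  assumes x: "x \<in> carr V" and y: "y \<in> carr V"
  shows "vnorm Q (coset V U (vadd V x y)) \<le> vnorm Q (coset V U x) + vnorm Q (coset V U y)"
proof -
  have 1: "vnorm Q (coset V U (vadd V x y)) \<le> vnorm V z + vnorm V w"
    if "z \<in> coset V U x" "w \<in> coset V U y" for z w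
  proof -
    have "vnorm Q (coset V U (vadd V x y)) \<le> vnorm V (vadd V z w)"
      using that x y by (intro quotient_norm_le) (simp_all add: mem_coset closed sub_add_add subspace)
    also have "\<dots> \<le> vnorm V z + vnorm V w"
      using that x y by (intro norm_triangle) (simp_all add: mem_coset)
    finally show ?thesis .
  qed
  have "vnorm Q (coset V U (vadd V x y)) - vnorm V w \<le> vnorm Q (coset V U x)"
    if "w \<in> coset V U y" for w
    using 1[OF _ that] by (intro le_quotient_norm x) (simp add: diff_le_eq)
  then have "vnorm Q (coset V U (vadd V x y)) - vnorm Q (coset V U x) \<le> vnorm Q (coset V U y)"
    by (intro le_quotient_norm y) (simp add: algebra_simps)
  then show ?thesis by simp
qed

lemma quotient_norm_scale:
  assumes x: "x \<in> carr V"
  shows "vnorm Q (coset V U (vscale V a x)) \<le> norm a * vnorm Q (coset V U x)"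
proof (cases "a = 0")
  case True
  \<comment> \<open>The argument of the other case divides by the norm of a. For a = 0 the zero
    vector represents the coset and bounds its norm by zero.\<close>
  have "vnorm Q (coset V U (vzero V)) \<le> vnorm V (vzero V)"
    by (intro quotient_norm_le zero_closed self_mem_coset)
  then show ?thesis using True x by (simp add: scale_zero_left norm_zero_eq)
next
  case False
  have "vnorm Q (coset V U (vscale V a x)) / norm a \<le> vnorm V z" if z: "z \<in> coset V U x" for z
  proof -
    have zc: "z \<in> carr V" and "vsub z x \<in> U" using z x by (simp_all add: mem_coset)
    then have "vsub (vscale V a z) (vscale V a x) \<in> U"
      using scale_sub[OF zc x, of a] subspace(4)[of "vsub z x" a] by simp
    then have "vnorm Q (coset V U (vscale V a x)) \<le> vnorm V (vscale V a z)"
      using x zc by (intro quotient_norm_le) (simp_all add: mem_coset closed)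
    also have "\<dots> \<le> norm a * vnorm V z" by (rule norm_scale_le[OF zc])
    finally show ?thesis using False by (simp add: divide_le_eq mult.commute)
  qed
  then have "vnorm Q (coset V U (vscale V a x)) / norm a \<le> vnorm Q (coset V U x)"
    by (rule le_quotient_norm[OF x])
  then show ?thesis using False by (simp add: divide_le_eq mult.commute)
qed

text \<open>Definiteness is closedness of \<open>U\<close>: a point outside \<open>U\<close> has a
  positive distance r from \<open>U\<close>, so every representative of its coset has norm at least
  r.\<close>

lemma quotient_norm_eq_zero:
  assumes x: "x \<in> carr V" and 0: "vnorm Q (coset V U x) = 0"
  shows "coset V U x = vzero Q"
proof (rule ccontr)
  assume "coset V U x \<noteq> vzero Q"
  then have "x \<notin> U" using coset_eq_zero_iff[OF x] by simp
  then obtain r where r: "r > 0" "\<And>u. u \<in> U \<Longrightarrow> r \<le> vnorm V (vsub x u)"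
    using closed_subspace x unfolding closed_subspace_iff by blast
  have "r \<le> vnorm V z" if z: "z \<in> coset V U x" for z
  proof -
    obtain u where u: "u \<in> U" "z = vadd V x u" using z by (auto simp: coset_def)
    then show ?thesis using r(2)[OF subspace(4)[OF u(1), of "- 1"]] by (simp add: neg_neg subspace)
  qed
  then show False using le_quotient_norm[OF x, of r] 0 r(1) by simp
qed

lemma normed_nspace_quotient: "normed_nspace Q"
proof
  show "vzero Q \<in> carr Q" using zero_closed by (auto simp: quotient_space_def)
next
  fix x y z a b assume "x \<in> carr Q"
  then obtain x' where x: "x' \<in> carr V" "x = coset V U x'" by (auto simp: carr_quotient)
  have z: "vzero Q = coset V U (vzero V)" by (simp add: quotient_space_def)
  note [simp] = closed quotient_add quotient_scale
  show "vscale Q a x \<in> carr Q" using x by (simp add: carr_quotient)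
  show "vadd Q (vzero Q) x = x" using x by (simp add: z add_zero_left)
  show "vadd Q x (vscale Q (- 1) x) = vzero Q" using x by (simp add: z add_neg)
  show "vscale Q (a + b) x = vadd Q (vscale Q a x) (vscale Q b x)" using x by (simp add: add_scale)
  show "vscale Q a (vscale Q b x) = vscale Q (a * b) x" using x by (simp add: scale_scale)
  show "vscale Q 1 x = x" using x by (simp add: scale_one)
  show "vnorm Q (vscale Q a x) \<le> norm a * vnorm Q x" using x by (simp add: quotient_norm_scale)
  show "x = vzero Q" if "vnorm Q x = 0" using quotient_norm_eq_zero[OF x(1)] that x(2) by simp
  assume "y \<in> carr Q"
  then obtain y' where y: "y' \<in> carr V" "y = coset V U y'" by (auto simp: carr_quotient)
  show "vadd Q x y \<in> carr Q" using x y by (simp add: carr_quotient)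
  show "vadd Q x y = vadd Q y x" using x y by (simp add: add_commute)
  show "vscale Q a (vadd Q x y) = vadd Q (vscale Q a x) (vscale Q a y)" using x y by (simp add: scale_add)
  show "vnorm Q (vadd Q x y) \<le> vnorm Q x + vnorm Q y" using x y by (simp add: quotient_norm_triangle)
  assume "z \<in> carr Q"
  then obtain z' where "z' \<in> carr V" "z = coset V U z'" by (auto simp: carr_quotient)
  then show "vadd Q (vadd Q x y) z = vadd Q x (vadd Q y z)" using x y by (simp add: add_assoc)
qed

lemma coset_bounded_op: "coset V U \<in> bounded_ops V Q"
proof -
  interpret normed_nspace_pair V Q
    using normed_nspace_axioms normed_nspace_quotient by (simp add: normed_nspace_pair_def)
  show ?thesis
    by (rule bounded_opsI[where K = 1])
      (auto simp: carr_quotient quotient_add quotient_scale quotient_norm_le self_mem_coset)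
qed

text \<open>The universal property of the quotient. All representatives z of a coset have the same
  image, so its norm is at most K times the norm of each z, and hence at most K times their
  infimum.\<close>

lemma quotient_lift:
  assumes W: "normed_nspace W" and f: "f \<in> bounded_ops V W" and fU: "\<And>u. u \<in> U \<Longrightarrow> f u = vzero W"
  shows "\<exists>g\<in>bounded_ops Q W. \<forall>x\<in>carr V. g (coset V U x) = f x"
proof -
  interpret W: normed_nspace_pair V W
    using W normed_nspace_axioms by (simp add: normed_nspace_pair_def)
  interpret Q: normed_nspace_pair Q W
    using W normed_nspace_quotient by (simp add: normed_nspace_pair_def)
  note [simp] = bounded_opsD[OF f]
  obtain K where K: "K > 0" "\<And>x. x \<in> carr V \<Longrightarrow> vnorm W (f x) \<le> K * vnorm V x"
    using W.op_bound[OF f] by blast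
  define g where "g S = f (SOME x. x \<in> S)" for S
  have f_eq: "f z = f x" if "x \<in> carr V" "z \<in> coset V U x" for x z
  proof -
    have "f (vsub z x) = vzero W" using that fU by (simp add: mem_coset)
    then show ?thesis using that W.W.sub_eq_zero[of "f z" "f x"] by (simp add: mem_coset closed)
  qed
  have g: "g (coset V U x) = f x" if "x \<in> carr V" for x
    unfolding g_def using f_eq[OF that] self_mem_coset[OF that] by (rule someI2[rotated])
  have "g \<in> bounded_ops Q W"
  proof (rule Q.bounded_opsI[where K = K])
    fix S assume "S \<in> carr Q"
    then obtain x where x: "x \<in> carr V" "S = coset V U x" by (auto simp: carr_quotient)
    show "g S \<in> carr W" using x by (simp add: g)
    show "g (vscale Q a S) = vscale W a (g S)" for a using x by (simp add: g quotient_scale closed)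
    have "vnorm W (f x) / K \<le> vnorm V z" if "z \<in> coset V U x" for z
      using K(2)[of z] f_eq[OF x(1) that] that x K(1) by (simp add: mem_coset divide_le_eq mult.commute)
    then have "vnorm W (f x) / K \<le> vnorm Q S" unfolding x(2) by (rule le_quotient_norm[OF x(1)])
    then show "vnorm W (g S) \<le> K * vnorm Q S" using x K(1) by (simp add: g divide_le_eq mult.commute)
    fix T assume "T \<in> carr Q"
    then obtain y where "y \<in> carr V" "T = coset V U y" by (auto simp: carr_quotient)
    then show "g (vadd Q S T) = vadd W (g S) (g T)" using x by (simp add: g quotient_add closed)
  qed
  then show ?thesis using g by blast
qed

text \<open>I - P vanishes on \<open>U\<close> and so descends to the quotient, where it is a
  bounded section of the coset map with values in the null space of \<open>P\<close>. This is how
  quotients become retracts.\<close>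

lemma quotient_section:
  assumes P: "P \<in> bounded_ops V V" and PU: "range_set V P = U" and idem: "\<And>u. u \<in> U \<Longrightarrow> P u = u"
  shows "\<exists>s\<in>bounded_ops Q V. (\<forall>x\<in>carr V. s (coset V U x) = vsub x (P x)) \<and>
    (\<forall>S\<in>carr Q. coset V U (s S) = S \<and> P (s S) = vzero V)"
proof -
  interpret p: normed_nspace_pair V V ..
  have Px: "P x \<in> U" if "x \<in> carr V" for x using that PU by (auto simp: range_set_def)
  note D = bounded_opsD[OF P]
  obtain s where s: "s \<in> bounded_ops Q V" "\<And>x. x \<in> carr V \<Longrightarrow> s (coset V U x) = vsub x (P x)"
    using quotient_lift[OF normed_nspace_axioms p.bounded_ops_diff[OF bounded_ops_id P]] idem
    by (auto simp: add_neg subspace)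
  moreover have "coset V U (s S) = S" "P (s S) = vzero V" if S: "S \<in> carr Q" for S
  proof -
    obtain x where x: "x \<in> carr V" "S = coset V U x" using S by (auto simp: carr_quotient)
    have "vsub (vsub x (P x)) x = vscale V (- 1) (P x)"
      using x D(1)[OF x(1)] add_sub[of "vscale V (- 1) (P x)" x] by (simp add: add_commute[of x] closed)
    then show "coset V U (s S) = S"
      using x D(1)[OF x(1)] Px[OF x(1)] by (simp add: s coset_eq_iff closed subspace)
    show "P (s S) = vzero V"
      using x D(1)[OF x(1)] idem[OF Px[OF x(1)]] by (simp add: s D closed add_neg)
  qed
  ultimately show ?thesis by blast
qed

end

section \<open>Retracts of Banach spaces\<close>

lemma banach_scalingD:
  assumes "banach_scaling s"
  shows "vector_space s" "s (of_real r) x = r *\<^sub>R x" "norm (s a x) = norm a * norm x"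
    "s a (x + y) = s a x + s a y" "s a (x - y) = s a x - s a y" "s a 0 = 0" "s (- 1) x = - x"
proof -
  show v: "vector_space s" and r: "s (of_real r) x = r *\<^sub>R x" for r x
    using assms by (simp_all add: banach_scaling_def)
  show "norm (s a x) = norm a * norm x" using assms by (simp add: banach_scaling_def)
  interpret vector_space s by (rule v)
  show "s a (x + y) = s a x + s a y" "s a (x - y) = s a x - s a y" "s a 0 = 0"
    by (simp_all add: scale_right_distrib scale_right_diff_distrib)
  show "s (- 1) x = - x" by simp
qed

lemma whole_space_simps [simp]:
  "carr (whole_space s) = UNIV" "vadd (whole_space s) = (+)" "vzero (whole_space s) = 0"
  "vscale (whole_space s) = s" "vnorm (whole_space s) = norm"
  by (simp_all add: whole_space_def)

lemma normed_nspace_whole_space: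
  assumes "banach_scaling s"
  shows "normed_nspace (whole_space s)"
proof -
  interpret vector_space s using assms by (rule banach_scalingD)
  show ?thesis
    by unfold_locales
      (simp_all add: banach_scalingD[OF assms] scale_left_distrib norm_triangle_ineq algebra_simps)
qed

text \<open>Real homogeneity is the case of scalars \<open>of_real r\<close>. The lemma opens the
  library of \<open>bounded_linear\<close>, with compatibility with the scalars in \<open>'k\<close>
  as a separate condition.\<close>

lemma bounded_ops_whole_space_iff:
  assumes "banach_scaling s" "banach_scaling t"
  shows "T \<in> bounded_ops (whole_space s) (whole_space t) \<longleftrightarrow>
    bounded_linear T \<and> (\<forall>a x. T (s a x) = t a (T x))"
proof
  assume T: "T \<in> bounded_ops (whole_space s) (whole_space t)"
  note D = bounded_opsD[OF T, simplified]
  obtain K where K: "norm (T x) \<le> K * norm x" for x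
    using T by (auto simp: bounded_ops_def)
  have "bounded_linear T"
  proof (rule bounded_linear_intro)
    show "T (r *\<^sub>R x) = r *\<^sub>R T x" for r x
      using D(3)[of "of_real r" x] banach_scalingD(2)[OF assms(1)] banach_scalingD(2)[OF assms(2)] by simp
    show "norm (T x) \<le> norm x * K" for x using K[of x] by (simp add: mult.commute)
  qed (rule D)
  then show "bounded_linear T \<and> (\<forall>a x. T (s a x) = t a (T x))" using D by blast
next
  assume T: "bounded_linear T \<and> (\<forall>a x. T (s a x) = t a (T x))"
  then obtain K where "\<And>x. norm (T x) \<le> norm x * K" using bounded_linear.bounded by blast
  then have "\<forall>x. norm (T x) \<le> K * norm x" by (simp add: mult.commute)
  then show "T \<in> bounded_ops (whole_space s) (whole_space t)"
    using T by (auto simp: bounded_ops_def linear_simps)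
qed

lemma closed_subspace_whole_space:
  assumes s: "banach_scaling s" and U: "closed_subspace (whole_space s) U"
  shows "subspace U" "closed U"
proof -
  have U': "0 \<in> U" "\<And>x y. x \<in> U \<Longrightarrow> y \<in> U \<Longrightarrow> x + y \<in> U" "\<And>a x. x \<in> U \<Longrightarrow> s a x \<in> U"
    using U by (auto simp: closed_subspace_def)
  have "r *\<^sub>R x \<in> U" if "x \<in> U" for r x
    using U'(3)[OF that, of "of_real r"] by (simp add: banach_scalingD(2)[OF s])
  then show "subspace U" using U' by (auto simp: Real_Vector_Spaces.subspace_def)
  show "closed U"
    using U closedin_whole_space[OF s] by (simp add: closed_subspace_def)
qed

text \<open>With a closed complement G of the image of \<open>S\<close>, the map (x, w) to f x + w
  is a bounded bijection from S x G onto the whole space. The open mapping theorem bounds its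
  inverse, whose first component is the left inverse.\<close>

lemma bounded_left_inverse_whole_space:
  fixes s :: "'k::real_normed_field \<Rightarrow> 'a::banach \<Rightarrow> 'a" and t :: "'k \<Rightarrow> 'b::banach \<Rightarrow> 'b"
  assumes s: "banach_scaling s" and t: "banach_scaling t"
    and f: "f \<in> bounded_ops (whole_space s) (whole_space t)"
    and S: "closed_subspace (whole_space s) S" and inj: "\<And>x. x \<in> S \<Longrightarrow> f x = 0 \<Longrightarrow> x = 0"
    and cc: "closed_complemented (whole_space t) (f ` S)"
  shows "\<exists>L\<in>bounded_ops (whole_space t) (whole_space s). range L \<subseteq> S \<and> (\<forall>x\<in>S. L (f x) = x)"
proof -
  obtain G where G: "closed_subspace (whole_space t) G" "f ` S \<inter> G = {0}"
    "{u + w | u w. u \<in> f ` S \<and> w \<in> G} = UNIV"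
    using cc by (auto simp: closed_complemented_def)
  note sS = closed_subspace_whole_space[OF s S] and sG = closed_subspace_whole_space[OF t G(1)]
  have fl: "bounded_linear f" and fs: "\<And>a x. f (s a x) = t a (f x)"
    using f by (simp_all add: bounded_ops_whole_space_iff s t)
  interpret f: bounded_linear f by (rule fl)
  define g where "g q = f (fst q) + snd q" for q
  have gl: "bounded_linear g"
    unfolding g_def
    by (intro bounded_linear_add bounded_linear_compose[OF fl] bounded_linear_fst bounded_linear_snd)
  interpret g: bounded_linear g by (rule gl)
  have ss: "subspace (S \<times> G)" by (rule subspace_Times[OF sS(1) sG(1)])
  have ker: "q = 0" if q: "q \<in> S \<times> G" "g q = 0" for q
  proof -
    have 1: "fst q \<in> S" "snd q \<in> G" using q by auto
    have "f (fst q) = - snd q" using q(2) by (simp add: g_def eq_neg_iff_add_eq_0)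
    then have "f (fst q) \<in> f ` S \<inter> G" using 1 subspace_neg[OF sG(1) 1(2)] by (metis IntI imageI)
    then have "f (fst q) = 0" unfolding G(2) by simp
    then show ?thesis using inj[OF 1(1)] q(2) by (simp add: g_def prod_eq_iff)
  qed
  have uniq: "q = q'" if "q \<in> S \<times> G" "q' \<in> S \<times> G" "g q = g q'" for q q'
    using ker[OF subspace_diff[OF ss that(1,2)]] that(3) by (simp add: g.diff)
  have surj: "\<exists>q\<in>S \<times> G. g q = y" for y
  proof -
    have "y \<in> {u + w | u w. u \<in> f ` S \<and> w \<in> G}" unfolding G(3) by simp
    then obtain x w where "x \<in> S" "w \<in> G" "y = f x + w" by blast
    then show ?thesis by (intro bexI[of _ "(x, w)"]) (auto simp: g_def)
  qed
  have "g ` (S \<times> G) = UNIV"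
  proof (intro equalityI subset_UNIV subsetI)
    show "y \<in> g ` (S \<times> G)" for y using surj[of y] by blast
  qed
  moreover have "inj_on g (S \<times> G)" by (intro inj_onI uniq)
  ultimately obtain K where K: "K \<ge> 0" "\<And>q. q \<in> S \<times> G \<Longrightarrow> norm q \<le> K * norm (g q)"
    using bounded_below_on_closed_range[OF gl ss closed_Times[OF sS(2) sG(2)]] by auto
  \<comment> \<open>\<open>p\<close> is the inverse of \<open>g\<close> on S x G. It is additive and
    homogeneous because preimages in S x G are unique.\<close>
  obtain p where p: "\<And>y. p y \<in> S \<times> G" "\<And>y. g (p y) = y" using surj by metis
  have sg: "(s a (fst q), t a (snd q)) \<in> S \<times> G" if "q \<in> S \<times> G" for a q
    using that S G(1) by (auto simp: closed_subspace_def)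
  have p_eq: "p y = q" if "q \<in> S \<times> G" "g q = y" for q y
    using uniq[OF p(1) that(1)] p(2) that(2) by simp
  have padd: "p (x + y) = p x + p y" for x y
    by (rule p_eq) (simp_all add: subspace_add[OF ss] p g.add)
  have pscale: "p (t a y) = (s a (fst (p y)), t a (snd (p y)))" for a y
  proof (rule p_eq)
    show "(s a (fst (p y)), t a (snd (p y))) \<in> S \<times> G" by (rule sg[OF p(1)])
    have "g (s a (fst (p y)), t a (snd (p y))) = t a (g (p y))"
      by (simp add: g_def fs banach_scalingD[OF t])
    then show "g (s a (fst (p y)), t a (snd (p y))) = t a y" by (simp add: p)
  qed
  have pf: "fst (p y) \<in> S" for y using p(1)[of y] by auto
  show ?thesis
  proof (intro bexI[of _ "\<lambda>y. fst (p y)"] conjI ballI)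
    have "norm (fst (p y)) \<le> K * norm y" for y
      using norm_fst_le[of "fst (p y)" "snd (p y)"] K(2)[OF p(1), of y] by (simp add: p(2))
    then show "(\<lambda>y. fst (p y)) \<in> bounded_ops (whole_space t) (whole_space s)"
      by (auto simp: bounded_ops_def padd pscale)
    show "range (\<lambda>y. fst (p y)) \<subseteq> S" using pf by auto
    show "fst (p (f x)) = x" if "x \<in> S" for x
      using p_eq[of "(x, 0)" "f x"] that subspace_0[OF sG(1)] by (simp add: g_def)
  qed
qed

text \<open>\<open>i\<close> identifies \<open>V\<close> with the closed subspace of the fixed points of \<open>i \<circ> r\<close>.\<close>

definition banach_retract :: "('k::real_normed_field \<Rightarrow> 'a::banach \<Rightarrow> 'a) \<Rightarrow> ('k, 'b) nspace \<Rightarrow> bool" where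
  "banach_retract s V \<longleftrightarrow> banach_scaling s \<and> normed_nspace V \<and>
     (\<exists>i\<in>bounded_ops V (whole_space s). \<exists>r\<in>bounded_ops (whole_space s) V. \<forall>x\<in>carr V. r (i x) = x)"

lemma banach_retract_whole_space: "banach_scaling s \<Longrightarrow> banach_retract s (whole_space s)"
  unfolding banach_retract_def
  by (intro conjI bexI[of _ "\<lambda>x. x"] ballI refl bounded_ops_id normed_nspace_whole_space)

text \<open>A retract of a retract is a retract: the embeddings and the retractions are
  composed.\<close>

lemma banach_retract_trans:
  assumes V: "banach_retract s V" and W: "normed_nspace W"
    and j: "j \<in> bounded_ops W V" and q: "q \<in> bounded_ops V W" and qj: "\<And>x. x \<in> carr W \<Longrightarrow> q (j x) = x"
  shows "banach_retract s W"
proof -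
  obtain i r where s: "banach_scaling s" and nV: "normed_nspace V"
    and i: "i \<in> bounded_ops V (whole_space s)" and r: "r \<in> bounded_ops (whole_space s) V"
    and ri: "\<And>x. x \<in> carr V \<Longrightarrow> r (i x) = x"
    using V unfolding banach_retract_def by blast
  note nS = normed_nspace_whole_space[OF s]
  show ?thesis
    unfolding banach_retract_def
  proof (intro conjI bexI[of _ "\<lambda>x. i (j x)"] bexI[of _ "\<lambda>x. q (r x)"] ballI s W)
    show "(\<lambda>x. i (j x)) \<in> bounded_ops W (whole_space s)"
      by (rule bounded_ops_compose[OF W nV nS j i])
    show "(\<lambda>x. q (r x)) \<in> bounded_ops (whole_space s) W"
      by (rule bounded_ops_compose[OF nS nV W r q])
    show "q (r (i (j x))) = x" if "x \<in> carr W" for x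
      using that by (simp add: ri bounded_opsD(1)[OF j] qj)
  qed
qed

text \<open>\<open>T\<close> is transported to the ambient Banach spaces, where
  \<open>bounded_left_inverse_whole_space\<close> applies, and the left inverse found there is
  transported back.\<close>

lemma left_invertible_left_inverse:
  assumes V: "banach_retract s V" and W: "banach_retract t W" and T: "left_invertible_op V W T"
  shows "\<exists>L\<in>bounded_ops W V. \<forall>x\<in>carr V. L (T x) = x"
proof -
  obtain iV rV where s: "banach_scaling s" and nV: "normed_nspace V"
    and iV: "iV \<in> bounded_ops V (whole_space s)" and rV: "rV \<in> bounded_ops (whole_space s) V"
    and riV: "\<And>x. x \<in> carr V \<Longrightarrow> rV (iV x) = x"
    using V unfolding banach_retract_def by blast
  obtain iW rW where t: "banach_scaling t" and nW: "normed_nspace W"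
    and iW: "iW \<in> bounded_ops W (whole_space t)" and rW: "rW \<in> bounded_ops (whole_space t) W"
    and riW: "\<And>x. x \<in> carr W \<Longrightarrow> rW (iW x) = x"
    using W unfolding banach_retract_def by blast
  note nS = normed_nspace_whole_space[OF s] and nT = normed_nspace_whole_space[OF t]
  interpret S: normed_nspace "whole_space s" by (rule nS)
  interpret T: normed_nspace "whole_space t" by (rule nT)
  interpret V: normed_nspace V by (rule nV)
  interpret W: normed_nspace W by (rule nW)
  interpret VS: normed_nspace_pair V "whole_space s" ..
  interpret WT: normed_nspace_pair W "whole_space t" ..
  interpret TW: normed_nspace_pair "whole_space t" W ..
  interpret VW: normed_nspace_pair V W ..
  have Tb: "T \<in> bounded_ops V W" and Tn: "null_set V W T = {vzero V}"
    using T by (simp_all add: left_invertible_op_def)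
  obtain G where R: "closed_subspace W (range_set V T)" and G: "closed_subspace W G"
    "range_set V T \<inter> G = {vzero W}"
    "{vadd W u w | u w. u \<in> range_set V T \<and> w \<in> G} = carr W"
    using T unfolding left_invertible_op_def closed_complemented_def by blast
  \<comment> \<open>\<open>U\<close> is the copy of \<open>V\<close> in its ambient space, and on it
    \<open>f\<close> acts as \<open>T\<close> does on \<open>V\<close>.\<close>
  define f where "f = (\<lambda>x. iW (T (rV x)))"
  define U where "U = {x \<in> carr (whole_space s). iV (rV x) = x}"
  have cV: "iV v \<in> U" if "v \<in> carr V" for v using riV[OF that] by (simp add: U_def)
  have f: "f \<in> bounded_ops (whole_space s) (whole_space t)"
    unfolding f_def
    by (intro bounded_ops_compose[OF nS nW nT _ iW] bounded_ops_compose[OF nS nV nW rV Tb])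
  have U: "closed_subspace (whole_space s) U"
    unfolding U_def by (rule S.closed_subspace_fixed[OF bounded_ops_compose[OF nS nV nS rV iV]])
  \<comment> \<open>Closedness of the image is read off this form: it is the copy of
    \<open>W\<close> intersected with the preimage of the range of \<open>T\<close>.\<close>
  have fU: "f ` U = {y \<in> carr (whole_space t). iW (rW y) = y} \<inter> {y \<in> carr (whole_space t). rW y \<in> range_set V T}"
  proof (intro equalityI subsetI)
    fix y assume "y \<in> f ` U"
    then obtain x where x: "x \<in> U" "y = iW (T (rV x))" by (auto simp: f_def)
    have "rV x \<in> carr V" using bounded_opsD(1)[OF rV] by simp
    then have "T (rV x) \<in> carr W" "T (rV x) \<in> range_set V T"
      using bounded_opsD(1)[OF Tb] by (auto simp: range_set_def)
    then show "y \<in> {y \<in> carr (whole_space t). iW (rW y) = y} \<inter> {y \<in> carr (whole_space t). rW y \<in> range_set V T}"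
      using x riW by simp
  next
    fix y assume y: "y \<in> {y \<in> carr (whole_space t). iW (rW y) = y} \<inter> {y \<in> carr (whole_space t). rW y \<in> range_set V T}"
    then obtain v where v: "v \<in> carr V" "rW y = T v" by (auto simp: range_set_def)
    then have "f (iV v) = y" using y riV[OF v(1)] by (simp add: f_def flip: v(2))
    then show "y \<in> f ` U" using cV[OF v(1)] by blast
  qed
  have cR: "closed_subspace (whole_space t) (f ` U)"
    unfolding fU
    by (intro T.closed_subspace_Int T.closed_subspace_fixed TW.closed_subspace_vimage[OF rW R]
        bounded_ops_compose[OF nT nW nT rW iW])
  \<comment> \<open>The copy of \<open>W\<close> may be a proper subspace, so the complement has to
    contain the null space of \<open>rW\<close> besides the copy of \<open>G\<close>. The preimage
    of \<open>G\<close> under \<open>rW\<close> is the sum of the two.\<close>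
  let ?H = "{y \<in> carr (whole_space t). rW y \<in> G}"
  have cH: "closed_subspace (whole_space t) ?H" by (rule TW.closed_subspace_vimage[OF rW G(1)])
  have "f ` U \<inter> ?H = {0}"
  proof (intro equalityI subsetI)
    fix y assume "y \<in> f ` U \<inter> ?H"
    then have "rW y \<in> range_set V T \<inter> G" "iW (rW y) = y" unfolding fU by auto
    then have "y = iW (vzero W)" unfolding G(2) by simp
    then show "y \<in> {0}" using WT.op_zero[OF iW] by simp
  next
    fix y :: 'd assume "y \<in> {0}"
    then show "y \<in> f ` U \<inter> ?H" using cR cH by (simp add: closed_subspace_def)
  qed
  moreover have "y \<in> {u + w | u w. u \<in> f ` U \<and> w \<in> ?H}" for y
  proof -
    have "rW y \<in> carr W" using bounded_opsD(1)[OF rW] by simp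
    then obtain v g where vg: "v \<in> carr V" "g \<in> G" "rW y = vadd W (T v) g"
      unfolding G(3)[symmetric] range_set_def by blast
    have gc: "g \<in> carr W" using vg(2) G(1) by (auto simp: closed_subspace_def)
    have Tv: "T v \<in> carr W" by (rule bounded_opsD(1)[OF Tb vg(1)])
    have "rW (y + t (- 1) (iW (T v))) = vadd W (rW y) (vscale W (- 1) (T v))"
      using bounded_opsD[OF rW] riW[OF Tv] by simp
    also have "\<dots> = g" using vg(3) W.add_sub[OF gc Tv] by (simp add: W.add_commute[OF gc Tv])
    finally have "y + t (- 1) (iW (T v)) \<in> ?H" using vg(2) by simp
    moreover have "y = iW (T v) + (y + t (- 1) (iW (T v)))" by (simp add: banach_scalingD[OF t])
    moreover have "iW (T v) \<in> f ` U"
      using cV[OF vg(1)] riV[OF vg(1)] by (auto simp: f_def image_iff intro!: bexI[of _ "iV v"])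
    ultimately show ?thesis by blast
  qed
  then have "{u + w | u w. u \<in> f ` U \<and> w \<in> ?H} = UNIV" by blast
  ultimately have cc: "closed_complemented (whole_space t) (f ` U)"
    unfolding closed_complemented_def using cR cH by (intro conjI exI[of _ ?H]) simp_all
  have inj: "x = 0" if x: "x \<in> U" "f x = 0" for x
  proof -
    have c: "rV x \<in> carr V" using bounded_opsD(1)[OF rV] by simp
    have "T (rV x) = rW (f x)" using riW[OF bounded_opsD(1)[OF Tb c]] by (simp add: f_def)
    also have "\<dots> = vzero W" using x(2) TW.op_zero[OF rW] by simp
    finally have "rV x \<in> null_set V W T" using c by (simp add: null_set_def)
    then have "rV x = vzero V" unfolding Tn by simp
    then show ?thesis using x(1) VS.op_zero[OF iV] by (simp add: U_def)
  qed
  obtain L where L: "L \<in> bounded_ops (whole_space t) (whole_space s)" "\<forall>x\<in>U. L (f x) = x"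
    using bounded_left_inverse_whole_space[OF s t f U inj cc] by blast
  show ?thesis
  proof (intro bexI[of _ "\<lambda>y. rV (L (iW y))"] ballI)
    show "(\<lambda>y. rV (L (iW y))) \<in> bounded_ops W V"
      by (intro bounded_ops_compose[OF nW nS nV _ rV] bounded_ops_compose[OF nW nT nS iW L(1)])
    show "rV (L (iW (T x))) = x" if x: "x \<in> carr V" for x
      using bspec[OF L(2) cV[OF x]] riV[OF x] by (simp add: f_def)
  qed
qed

section \<open>Upper triangular operators\<close>

text \<open>A bijective operator is left invertible, as its range is the whole carrier with
  complement zero; by surjectivity the bounded left inverse is two-sided.\<close>

lemma invertible_op_inverse:
  assumes V: "banach_retract s V" and W: "banach_retract t W" and T: "invertible_op V W T"
  shows "\<exists>L\<in>bounded_ops W V. (\<forall>x\<in>carr V. L (T x) = x) \<and> (\<forall>y\<in>carr W. T (L y) = y)"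
proof -
  interpret normed_nspace_pair V W
    using V W by (simp add: banach_retract_def normed_nspace_pair_def)
  have Tb: "T \<in> bounded_ops V W" and bij: "bij_betw T (carr V) (carr W)"
    using T by (simp_all add: invertible_op_def)
  have "x = vzero V" if "x \<in> carr V" "T x = vzero W" for x
    using bij_betw_imp_inj_on[OF bij] V.zero_closed that op_zero[OF Tb] by (metis inj_onD)
  then have "null_set V W T = {vzero V}"
    unfolding null_set_def using V.zero_closed op_zero[OF Tb] by blast
  moreover have R: "range_set V T = carr W"
    using bij by (simp add: range_set_def bij_betw_def)
  ultimately have "left_invertible_op V W T"
    using Tb W.closed_complemented_carr by (simp add: left_invertible_op_def)
  then obtain L where L: "L \<in> bounded_ops W V" "\<forall>x\<in>carr V. L (T x) = x"
    using left_invertible_left_inverse[OF V W] by blast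
  have "T (L y) = y" if y: "y \<in> carr W" for y
  proof -
    obtain x where "x \<in> carr V" "y = T x" using y unfolding R[symmetric] range_set_def by blast
    then show ?thesis using L(2) by simp
  qed
  then show ?thesis using L by blast
qed

text \<open>A left inverse of the identity on \<open>U\<close> with values in \<open>U\<close> is a
  projection onto \<open>U\<close>.\<close>

lemma closed_complemented_imp_projection:
  assumes s: "banach_scaling s" and U: "closed_complemented (whole_space s) U"
  shows "\<exists>P\<in>bounded_ops (whole_space s) (whole_space s). range P \<subseteq> U \<and> (\<forall>x\<in>U. P x = x)"
  using bounded_left_inverse_whole_space[OF s s bounded_ops_id, of U] U
  by (simp add: closed_complemented_def)

section \<open>Products of Banach spaces\<close>

definition prod_scaling :: "('k \<Rightarrow> 'a \<Rightarrow> 'a) \<Rightarrow> ('k \<Rightarrow> 'b \<Rightarrow> 'b) \<Rightarrow> 'k \<Rightarrow> 'a \<times> 'b \<Rightarrow> 'a \<times> 'b" where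
  "prod_scaling s t a p = (s a (fst p), t a (snd p))"

text \<open>Makes an iterated product a whole space over a product type, so that the results on
  whole spaces apply to operator matrices.\<close>

lemma prod_space_whole_space:
  "prod_space (whole_space s) (whole_space t) = whole_space (prod_scaling s t)"
  by (simp add: prod_space_def whole_space_def prod_scaling_def fun_eq_iff norm_prod_def plus_prod_def
      zero_prod_def)

lemma banach_scaling_prod:
  assumes s: "banach_scaling s" and t: "banach_scaling t"
  shows "banach_scaling (prod_scaling s t)"
proof -
  interpret s: vector_space s using s by (rule banach_scalingD)
  interpret t: vector_space t using t by (rule banach_scalingD)
  have "vector_space (prod_scaling s t)"
    by unfold_locales (simp_all add: prod_scaling_def s.scale_left_distrib t.scale_left_distrib
        s.scale_right_distrib t.scale_right_distrib)
  moreover have "norm (prod_scaling s t a p) = norm a * norm p" for a p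
    by (simp add: prod_scaling_def norm_prod_def banach_scalingD[OF s] banach_scalingD[OF t]
        power_mult_distrib real_sqrt_mult flip: distrib_left)
  ultimately show ?thesis
    by (simp add: banach_scaling_def prod_scaling_def banach_scalingD[OF s] banach_scalingD[OF t]
        scaleR_prod_def)
qed

lemma sub_space_prod_space:
  "prod_space (sub_space V U) (sub_space W U') = sub_space (prod_space V W) (U \<times> U')"
  by (simp add: prod_space_def sub_space_def)

lemma bounded_ops_Pair:
  assumes "normed_nspace V" "normed_nspace W" "normed_nspace W'"
    and f: "f \<in> bounded_ops V W" and g: "g \<in> bounded_ops V W'"
  shows "(\<lambda>x. (f x, g x)) \<in> bounded_ops V (prod_space W W')"
proof -
  interpret f: normed_nspace_pair V W using assms by (simp add: normed_nspace_pair_def)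
  interpret g: normed_nspace_pair V W' using assms by (simp add: normed_nspace_pair_def)
  obtain K where K: "\<And>x. x \<in> carr V \<Longrightarrow> vnorm W (f x) \<le> K * vnorm V x" using f.op_bound[OF f] by blast
  obtain L where L: "\<And>x. x \<in> carr V \<Longrightarrow> vnorm W' (g x) \<le> L * vnorm V x" using g.op_bound[OF g] by blast
  note [simp] = bounded_opsD[OF f] bounded_opsD[OF g]
  have "norm (vnorm W (f x), vnorm W' (g x)) \<le> (K + L) * vnorm V x" if x: "x \<in> carr V" for x
  proof -
    have "norm (vnorm W (f x), vnorm W' (g x)) \<le> norm (vnorm W (f x)) + norm (vnorm W' (g x))"
      by (rule norm_Pair_le)
    also have "\<dots> = vnorm W (f x) + vnorm W' (g x)"
      using x by (simp add: f.W.norm_nonneg g.W.norm_nonneg)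
    also have "\<dots> \<le> (K + L) * vnorm V x" using K[OF x] L[OF x] by (simp add: distrib_right)
    finally show ?thesis .
  qed
  then have "\<exists>K. \<forall>x\<in>carr V. norm (vnorm W (f x), vnorm W' (g x)) \<le> K * vnorm V x" by blast
  then show ?thesis by (auto simp: bounded_ops_def prod_space_def)
qed

lemma coset_whole_space_eq_iff:
  assumes s: "banach_scaling s" and U: "closed_subspace (whole_space s) U"
  shows "coset (whole_space s) U x = coset (whole_space s) U y \<longleftrightarrow> x - y \<in> U"
proof -
  interpret nspace_quotient "whole_space s" U
    using normed_nspace_whole_space[OF s] U by (simp add: nspace_quotient_def nspace_quotient_axioms_def)
  show ?thesis using coset_eq_iff[of x y] by (simp add: banach_scalingD[OF s])
qed

section \<open>The diagonal operators and the projections given by an inner inverse of B\<close>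

locale triangular_operator =
  fixes sX :: "'k::real_normed_field \<Rightarrow> 'x::banach \<Rightarrow> 'x"
    and sY :: "'k \<Rightarrow> 'y::banach \<Rightarrow> 'y"
    and sZ :: "'k \<Rightarrow> 'z::banach \<Rightarrow> 'z"
    and A :: "'x \<Rightarrow> 'x" and B B' :: "'y \<Rightarrow> 'y" and C :: "'z \<Rightarrow> 'z"
  assumes sX: "banach_scaling sX" and sY: "banach_scaling sY" and sZ: "banach_scaling sZ"
    and A: "A \<in> bounded_ops (whole_space sX) (whole_space sX)"
    and B: "B \<in> bounded_ops (whole_space sY) (whole_space sY)"
    and B': "B' \<in> bounded_ops (whole_space sY) (whole_space sY)"
    and C: "C \<in> bounded_ops (whole_space sZ) (whole_space sZ)"
    and BB'B: "B (B' (B y)) = B y"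
begin

abbreviation "X \<equiv> whole_space sX"
abbreviation "Y \<equiv> whole_space sY"
abbreviation "Z \<equiv> whole_space sZ"
abbreviation "XYZ \<equiv> whole_space (prod_scaling sX (prod_scaling sY sZ))"
abbreviation "NB \<equiv> sub_space Y (null_set Y Y B)"
abbreviation "NC \<equiv> sub_space Z (null_set Z Z C)"
abbreviation "XA \<equiv> quotient_space X (range_set X A)"
abbreviation "YB \<equiv> quotient_space Y (range_set Y B)"

lemma XYZ: "prod_space X (prod_space Y Z) = XYZ"
  by (simp add: prod_space_whole_space)

lemmas sYZ = banach_scaling_prod[OF sY sZ]
lemmas sXYZ = banach_scaling_prod[OF sX sYZ]
lemmas nX = normed_nspace_whole_space[OF sX]
lemmas nY = normed_nspace_whole_space[OF sY]
lemmas nZ = normed_nspace_whole_space[OF sZ]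

lemma op_simps:
  assumes "T \<in> bounded_ops (whole_space s) (whole_space t)" "banach_scaling s" "banach_scaling t"
  shows "T (x + y) = T x + T y" "T (x - y) = T x - T y" "T 0 = 0" "T (- x) = - T x" "T (s a x) = t a (T x)"
proof -
  have "bounded_linear T" using assms by (simp add: bounded_ops_whole_space_iff)
  from linear_simps[OF this] show "T (x + y) = T x + T y" "T (x - y) = T x - T y" "T 0 = 0" "T (- x) = - T x"
    by simp_all
  show "T (s a x) = t a (T x)" using assms by (simp add: bounded_ops_whole_space_iff)
qed

lemmas A_simps = op_simps[OF A sX sX]
lemmas B_simps = op_simps[OF B sY sY]
lemmas B'_simps = op_simps[OF B' sY sY]
lemmas C_simps = op_simps[OF C sZ sZ]

lemma ops_bounded_linear: "bounded_linear A" "bounded_linear B" "bounded_linear B'" "bounded_linear C"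
  using A B B' C by (simp_all add: bounded_ops_whole_space_iff sX sY sZ)

lemma mem_null: "y \<in> null_set Y Y B \<longleftrightarrow> B y = 0" "z \<in> null_set Z Z C \<longleftrightarrow> C z = 0"
  by (simp_all add: null_set_def)

lemma NB_simps:
  "y \<in> carr NB \<longleftrightarrow> B y = 0" "vadd NB = (+)" "vzero NB = 0" "vscale NB = sY" "vnorm NB = norm"
  by (simp_all add: sub_space_def mem_null)

lemma NC_simps:
  "z \<in> carr NC \<longleftrightarrow> C z = 0" "vadd NC = (+)" "vzero NC = 0" "vscale NC = sZ" "vnorm NC = norm"
  by (simp_all add: sub_space_def mem_null)

lemma nNB: "normed_nspace NB"
proof -
  interpret Y: normed_nspace Y by (rule nY)
  interpret YY: normed_nspace_pair Y Y ..
  show ?thesis by (rule Y.normed_nspace_sub_space[OF YY.closed_subspace_null_set[OF B]])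
qed

lemma nNC: "normed_nspace NC"
proof -
  interpret Z: normed_nspace Z by (rule nZ)
  interpret ZZ: normed_nspace_pair Z Z ..
  show ?thesis by (rule Z.normed_nspace_sub_space[OF ZZ.closed_subspace_null_set[OF C]])
qed

text \<open>By B B' B = B this is the projection onto N(B) along the range of B' B.\<close>

definition P where "P y = y - B' (B y)"

lemma P_null: "B (P y) = 0" and P_fixed: "B y = 0 \<Longrightarrow> P y = y"
  by (simp_all add: P_def B_simps B'_simps BB'B)

lemma P_op: "P \<in> bounded_ops Y NB"
proof -
  have "P \<in> bounded_ops Y Y"
    unfolding P_def[abs_def] bounded_ops_whole_space_iff[OF sY sY]
    by (auto simp: B_simps B'_simps banach_scalingD[OF sY]
        intro!: bounded_linear_sub bounded_linear_ident bounded_linear_compose[of B'] ops_bounded_linear)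
  moreover have "null_set Y Y B \<subseteq> carr Y" by simp
  ultimately show ?thesis by (auto simp: bounded_ops_sub_space_iff mem_null P_null)
qed

lemma NB_incl: "(\<lambda>y. y) \<in> bounded_ops NB Y"
  by (rule bounded_ops_restrict[OF bounded_ops_id]) simp

lemma NC_incl: "(\<lambda>z. z) \<in> bounded_ops NC Z"
  by (rule bounded_ops_restrict[OF bounded_ops_id]) simp

lemma BB'_op: "(\<lambda>y. B (B' y)) \<in> bounded_ops Y Y"
  by (rule bounded_ops_compose[OF nY nY nY B' B])

lemma range_BB': "range_set Y (\<lambda>y. B (B' y)) = range_set Y B"
  using BB'B by (auto simp: range_set_def image_iff) metis

text \<open>B B' is idempotent and has the same range as \<open>B\<close>.\<close>

lemma closed_range_B: "closed_subspace Y (range_set Y B)"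
proof -
  interpret Y: normed_nspace Y by (rule nY)
  show ?thesis
    using Y.closed_complemented_projection(1)[OF BB'_op] BB'B
    by (simp add: closed_complemented_def range_BB')
qed

sublocale YB: nspace_quotient Y "range_set Y B"
  using nY closed_range_B by (simp add: nspace_quotient_def nspace_quotient_axioms_def)

lemma mem_range: "x \<in> range_set X A \<longleftrightarrow> (\<exists>u. x = A u)" "y \<in> range_set Y B \<longleftrightarrow> (\<exists>v. y = B v)"
  by (auto simp: range_set_def)

lemma upper_triangular_op:
  assumes D: "D \<in> bounded_ops Y X" and E: "E \<in> bounded_ops Z X" and F: "F \<in> bounded_ops Z Y"
  shows "upper_triangular A B C D E F \<in> bounded_ops XYZ XYZ"
proof -
  note bl = D[unfolded bounded_ops_whole_space_iff[OF sY sX]] E[unfolded bounded_ops_whole_space_iff[OF sZ sX]]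
    F[unfolded bounded_ops_whole_space_iff[OF sZ sY]]
  have eq: "upper_triangular A B C D E F =
      (\<lambda>p. (A (fst p) + D (fst (snd p)) + E (snd (snd p)), B (fst (snd p)) + F (snd (snd p)), C (snd (snd p))))"
    by (auto simp: upper_triangular_def)
  have "bounded_linear (upper_triangular A B C D E F)"
    unfolding eq
    by (intro bounded_linear_Pair bounded_linear_add ops_bounded_linear[THEN bounded_linear_compose]
        bl[THEN conjunct1, THEN bounded_linear_compose] bounded_linear_fst
        bounded_linear_fst_comp[OF bounded_linear_snd] bounded_linear_snd_comp[OF bounded_linear_snd])
  then show ?thesis
    using bl by (auto simp: bounded_ops_whole_space_iff[OF sXYZ sXYZ] eq prod_scaling_def
        A_simps B_simps C_simps banach_scalingD[OF sX] banach_scalingD[OF sY])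
qed

section \<open>Necessary conditions read off the blocks of the inverse matrix\<close>

lemma invertible_upper_triangular_imp:
  assumes D: "D \<in> bounded_ops Y X" and E: "E \<in> bounded_ops Z X" and F: "F \<in> bounded_ops Z Y"
    and inv: "invertible_op XYZ XYZ (upper_triangular A B C D E F)"
  shows "left_invertible_op X X A" "right_invertible_op Z Z C" "NB \<preceq>\<^sub>B XA" "YB \<preceq>\<^sub>B NC"
    "prod_space NB NC \<cong>\<^sub>B prod_space XA YB"
proof -
  interpret X: normed_nspace X by (rule nX)
  interpret Z: normed_nspace Z by (rule nZ)
  interpret XX: normed_nspace_pair X X ..
  interpret ZZ: normed_nspace_pair Z Z ..
  let ?M = "upper_triangular A B C D E F"
  note lin = A_simps B_simps B'_simps C_simps op_simps[OF D sY sX] op_simps[OF E sZ sX] op_simps[OF F sZ sY]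
  obtain N where N: "N \<in> bounded_ops XYZ XYZ" and NM: "\<And>p. N (?M p) = p" and MN: "\<And>p. ?M (N p) = p"
    using invertible_op_inverse[OF _ _ inv] banach_retract_whole_space[OF sXYZ] by fastforce
  have blD: "bounded_linear D" "bounded_linear E" "bounded_linear F"
    using D E F by (simp_all add: bounded_ops_whole_space_iff sX sY sZ)
  have N0: "N (0, 0, 0) = (0, 0, 0)" using op_simps(3)[OF N sXYZ sXYZ] by (simp add: zero_prod_def)
  have bl: "bounded_linear N" and Ns: "\<And>a p. N (prod_scaling sX (prod_scaling sY sZ) a p) = prod_scaling sX (prod_scaling sY sZ) a (N p)"
    using iffD1[OF bounded_ops_whole_space_iff[OF sXYZ sXYZ] N] by blast+
  \<comment> \<open>The block \<open>nij\<close> of \<open>N\<close> leads from the j-th summand to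
    the i-th. \<open>n11\<close> will be a left inverse of \<open>A\<close> and \<open>n33\<close> a
    right inverse of \<open>C\<close>; \<open>n21\<close> and \<open>n32\<close> serve the two
    embeddings.\<close>
  define n11 where "n11 x = fst (N (x, 0, 0))" for x
  define n21 where "n21 x = fst (snd (N (x, 0, 0)))" for x
  define n32 where "n32 y = snd (snd (N (0, y, 0)))" for y
  define n33 where "n33 z = snd (snd (N (0, 0, z)))" for z
  note blN = bounded_linear_fst_comp bounded_linear_snd_comp
    bounded_linear_compose[OF bl] bounded_linear_Pair bounded_linear_ident bounded_linear_zero
  have n11: "n11 \<in> bounded_ops X X"
    unfolding n11_def[abs_def] bounded_ops_whole_space_iff[OF sX sX]
    using Ns[of _ "(_, 0, 0)"] by (auto simp: prod_scaling_def banach_scalingD[OF sY] banach_scalingD[OF sZ] intro!: blN)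
  have n21: "n21 \<in> bounded_ops X Y"
    unfolding n21_def[abs_def] bounded_ops_whole_space_iff[OF sX sY]
    using Ns[of _ "(_, 0, 0)"] by (auto simp: prod_scaling_def banach_scalingD[OF sY] banach_scalingD[OF sZ] intro!: blN)
  have n32: "n32 \<in> bounded_ops Y Z"
    unfolding n32_def[abs_def] bounded_ops_whole_space_iff[OF sY sZ]
    using Ns[of _ "(0, _, 0)"] by (auto simp: prod_scaling_def banach_scalingD[OF sX] banach_scalingD[OF sZ] intro!: blN)
  have n33: "n33 \<in> bounded_ops Z Z"
    unfolding n33_def[abs_def] bounded_ops_whole_space_iff[OF sZ sZ]
    using Ns[of _ "(0, 0, _)"] by (auto simp: prod_scaling_def banach_scalingD[OF sX] banach_scalingD[OF sY] intro!: blN)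
  have NA: "N (A x, 0, 0) = (x, 0, 0)" for x
    using NM[of "(x, 0, 0)"] by (simp add: upper_triangular_def lin)
  have MN': "A a + D b + E c = x \<and> B b + F c = y \<and> C c = z" if "N (x, y, z) = (a, b, c)" for a b c x y z
    using MN[of "(x, y, z)"] that by (simp add: upper_triangular_def)
  show li: "left_invertible_op X X A"
    by (rule XX.left_invertible_opI[OF A n11]) (simp add: n11_def NA)
  have "C (n33 z) = z" for z
    using MN'[of 0 0 z] by (cases "N (0, 0, z)") (simp add: n33_def)
  then show "right_invertible_op Z Z C"
    by (intro ZZ.right_invertible_opI[OF C n33]) simp
  have cA: "closed_subspace X (range_set X A)"
    using li by (simp add: left_invertible_op_def closed_complemented_def)
  interpret XA: nspace_quotient X "range_set X A"
    using nX cA by (simp add: nspace_quotient_def nspace_quotient_axioms_def)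
  note nXA = XA.normed_nspace_quotient and nYB = YB.normed_nspace_quotient
  interpret p1: normed_nspace_pair NB XA using nNB nXA by (simp add: normed_nspace_pair_def)
  interpret p2: normed_nspace_pair YB NC using nNC nYB by (simp add: normed_nspace_pair_def)
  note coset_X = coset_whole_space_eq_iff[OF sX cA] and coset_Y = coset_whole_space_eq_iff[OF sY closed_range_B]
  have J1: "(\<lambda>y. coset X (range_set X A) (D y)) \<in> bounded_ops NB XA"
    by (intro bounded_ops_compose[OF nNB nX nXA _ XA.coset_bounded_op]
        bounded_ops_compose[OF nNB nY nX NB_incl D])
  \<comment> \<open>By \<open>NA\<close> the block \<open>n21\<close> vanishes on R(A), so its
    composition with \<open>P\<close> descends to X/R(A). There it is a left inverse of the map
    induced by \<open>D\<close>: for y in N(B) the matrix sends (0, y, 0) to (D y, 0, 0).\<close>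
  have "P (n21 u) = vzero NB" if "u \<in> range_set X A" for u
    using that by (auto simp: range_set_def n21_def NA P_def lin NB_simps)
  then obtain g where g: "g \<in> bounded_ops XA NB" "\<And>x. g (coset X (range_set X A) x) = P (n21 x)"
    using XA.quotient_lift[OF nNB bounded_ops_compose[OF nX nY nNB n21 P_op]] by auto
  have "g (coset X (range_set X A) (D y)) = y" if "y \<in> carr NB" for y
  proof -
    have "B y = 0" using that by (simp add: NB_simps)
    then have "N (D y, 0, 0) = (0, y, 0)"
      using NM[of "(0, y, 0)"] by (simp add: upper_triangular_def lin)
    then show ?thesis using \<open>B y = 0\<close> by (simp add: g n21_def P_fixed)
  qed
  then show "NB \<preceq>\<^sub>B XA" using p1.left_invertible_opI[OF J1 g(1)] by (auto simp: embeds_def)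
  \<comment> \<open>The block \<open>n32\<close> may fail to vanish on R(B). Precomposed with I - B
    B', which does vanish there, it descends to Y/R(B).\<close>
  have Q: "(\<lambda>y. y - B (B' y)) \<in> bounded_ops Y Y"
    unfolding bounded_ops_whole_space_iff[OF sY sY]
    by (auto simp: B_simps B'_simps banach_scalingD[OF sY]
        intro!: bounded_linear_sub bounded_linear_ident ops_bounded_linear[THEN bounded_linear_compose])
  \<comment> \<open>The last two rows of M N (0, y, 0) = (0, y, 0). They put the values of
    \<open>n32\<close> into N(C) and make \<open>F\<close> undo \<open>n32\<close> modulo
    R(B).\<close>
  have n32_eq: "C (n32 y) = 0 \<and> (\<exists>v. B v + F (n32 y) = y)" for y
    using MN'[of 0 y 0] by (cases "N (0, y, 0)") (auto simp: n32_def)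
  have "(\<lambda>y. n32 (y - B (B' y))) \<in> bounded_ops Y NC"
    using bounded_ops_compose[OF nY nY nZ Q n32] n32_eq by (auto simp: bounded_ops_sub_space_iff mem_null)
  moreover have "n32 (u - B (B' u)) = vzero NC" if "u \<in> range_set Y B" for u
    using that by (auto simp: range_set_def BB'B n32_def N0 NC_simps)
  ultimately obtain h where h: "h \<in> bounded_ops YB NC"
    "\<And>y. h (coset Y (range_set Y B) y) = n32 (y - B (B' y))"
    using YB.quotient_lift[OF nNC] by fastforce
  have L2: "(\<lambda>z. coset Y (range_set Y B) (F z)) \<in> bounded_ops NC YB"
    by (intro bounded_ops_compose[OF nNC nY nYB _ YB.coset_bounded_op]
        bounded_ops_compose[OF nNC nZ nY NC_incl F])
  have "coset Y (range_set Y B) (F (h S)) = S" if S: "S \<in> carr YB" for S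
  proof -
    obtain y where y: "S = coset Y (range_set Y B) y" using S by (auto simp: YB.carr_quotient)
    obtain v where v: "B v + F (n32 (y - B (B' y))) = y - B (B' y)" using n32_eq by blast
    have "F (n32 (y - B (B' y))) - y = B (- (B' y + v))"
      using v by (simp add: lin algebra_simps)
    then have "F (n32 (y - B (B' y))) - y \<in> range_set Y B" unfolding mem_range by blast
    then show ?thesis by (simp add: y h coset_Y)
  qed
  then show "YB \<preceq>\<^sub>B NC" using p2.left_invertible_opI[OF h(1) L2] by (auto simp: embeds_def)
  \<comment> \<open>The correction by B' F z is chosen for the second row of the matrix: for y in
    N(B) and F z in R(B) it gives B (y - B' F z) + F z = 0.\<close>
  define T where "T p = (coset X (range_set X A) (D (fst p - B' (F (snd p))) + E (snd p)),
    coset Y (range_set Y B) (F (snd p)))" for p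
  let ?K = "null_set Y Y B \<times> null_set Z Z C"
  note nYZ = normed_nspace_whole_space[OF sYZ]
  have dom: "prod_space NB NC = sub_space (whole_space (prod_scaling sY sZ)) ?K"
    by (simp add: sub_space_prod_space prod_space_whole_space)
  have T1: "(\<lambda>p. D (fst p - B' (F (snd p))) + E (snd p)) \<in> bounded_ops (whole_space (prod_scaling sY sZ)) X"
    unfolding bounded_ops_whole_space_iff[OF sYZ sX]
    by (auto simp: prod_scaling_def lin banach_scalingD[OF sX] banach_scalingD[OF sY]
        intro!: bounded_linear_add bounded_linear_sub ops_bounded_linear[THEN bounded_linear_compose]
          blD[THEN bounded_linear_compose] bounded_linear_fst bounded_linear_snd)
  have T2: "(\<lambda>p. F (snd p)) \<in> bounded_ops (whole_space (prod_scaling sY sZ)) Y"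
    unfolding bounded_ops_whole_space_iff[OF sYZ sY]
    by (auto simp: prod_scaling_def lin intro!: blD[THEN bounded_linear_compose] bounded_linear_snd)
  have T: "T \<in> bounded_ops (prod_space NB NC) (prod_space XA YB)"
    unfolding dom T_def[abs_def]
    by (rule bounded_ops_restrict, rule bounded_ops_Pair[OF nYZ nXA nYB
          bounded_ops_compose[OF nYZ nX nXA T1 XA.coset_bounded_op]
          bounded_ops_compose[OF nYZ nY nYB T2 YB.coset_bounded_op]]) simp
  \<comment> \<open>Equal cosets make the differences, with the corrected second entry and a
    suitable first entry, a vector in the kernel of the matrix.\<close>
  have inj: "y = y' \<and> z = z'"
    if nul: "B y = 0" "B y' = 0" "C z = 0" "C z' = 0" and eq: "T (y, z) = T (y', z')" for y y' z z'
  proof -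
    obtain u where u: "D (y - B' (F z)) + E z - (D (y' - B' (F z')) + E z') = A u"
      using eq by (auto simp: T_def coset_X mem_range)
    obtain v where v: "F z - F z' = B v" using eq by (auto simp: T_def coset_Y mem_range)
    have BF: "B (B' (F z)) - B (B' (F z')) = F z - F z'"
      using BB'B[of v] by (simp add: lin flip: v)
    have "A (- u) + D ((y - y') - B' (F (z - z'))) + E (z - z') = 0"
      using u by (simp add: lin algebra_simps)
    moreover have "B ((y - y') - B' (F (z - z'))) + F (z - z') = 0"
      using BF nul by (simp add: lin algebra_simps)
    ultimately have "?M (- u, (y - y') - B' (F (z - z')), z - z') = (0, 0, 0)"
      using nul by (simp add: upper_triangular_def lin)
    then have "(- u, (y - y') - B' (F (z - z')), z - z') = (0, 0, 0)"
      using NM[of "(- u, (y - y') - B' (F (z - z')), z - z')"] N0 by simp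
    then show ?thesis by (auto simp: lin)
  qed
  have surj: "\<exists>y z. B y = 0 \<and> C z = 0 \<and> T (y, z) = (coset X (range_set X A) x, coset Y (range_set Y B) y0)" for x y0
  proof -
    \<comment> \<open>Solve M (a, b, c) = (x, y0 - B B' y0, 0). Applying B B' to the second row
      gives B B' F c = - B b, so b + B' F c lies in N(B); paired with c it is the required
      preimage.\<close>
    obtain a b c where abc: "N (x, y0 - B (B' y0), 0) = (a, b, c)" by (cases "N (x, y0 - B (B' y0), 0)")
    then have eqs: "A a + D b + E c = x" "B b + F c = y0 - B (B' y0)" "C c = 0" using MN' by blast+
    have Fc: "F c = (y0 - B (B' y0)) - B b" using eqs(2) by (simp add: eq_diff_eq add.commute)
    have "B (B' (F c)) = B (B' ((y0 - B (B' y0)) - B b))" unfolding Fc ..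
    also have "\<dots> = - B b" by (simp add: lin BB'B)
    finally have BF: "B (B' (F c)) = - B b" .
    have 1: "D b + E c - x = A (- a)" unfolding eqs(1)[symmetric] by (simp add: lin)
    have 2: "F c - y0 = B (- (b + B' y0))" unfolding Fc by (simp add: lin)
    have "D b + E c - x \<in> range_set X A" "F c - y0 \<in> range_set Y B"
      unfolding mem_range using 1 2 by blast+
    then have "T (b + B' (F c), c) = (coset X (range_set X A) x, coset Y (range_set Y B) y0)"
      by (simp add: T_def coset_X coset_Y)
    moreover have "B (b + B' (F c)) = 0" using BF by (simp add: lin)
    ultimately show ?thesis using eqs(3) by blast
  qed
  have carr_dom: "p \<in> carr (prod_space NB NC) \<longleftrightarrow> B (fst p) = 0 \<and> C (snd p) = 0" for p
    by (cases p) (simp add: prod_space_def NB_simps NC_simps)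
  have "bij_betw T (carr (prod_space NB NC)) (carr (prod_space XA YB))"
    unfolding bij_betw_def
  proof (intro conjI equalityI subsetI)
    show "inj_on T (carr (prod_space NB NC))"
    proof (rule inj_onI)
      fix p q assume "p \<in> carr (prod_space NB NC)" "q \<in> carr (prod_space NB NC)" "T p = T q"
      then show "p = q" using inj[of "fst p" "fst q" "snd p" "snd q"] by (simp add: carr_dom prod_eq_iff)
    qed
    show "q \<in> carr (prod_space XA YB)" if "q \<in> T ` carr (prod_space NB NC)" for q
      using that bounded_opsD(1)[OF T] by blast
    fix q assume "q \<in> carr (prod_space XA YB)"
    then obtain x y0 where "q = (coset X (range_set X A) x, coset Y (range_set Y B) y0)"
      by (auto simp: prod_space_def XA.carr_quotient YB.carr_quotient)
    then obtain y z where "B y = 0" "C z = 0" "T (y, z) = q" using surj by blast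
    then show "q \<in> T ` carr (prod_space NB NC)"
      by (intro image_eqI[of _ _ "(y, z)"]) (simp_all add: carr_dom)
  qed
  then show "prod_space NB NC \<cong>\<^sub>B prod_space XA YB"
    using T by (auto simp: isomorphic_spaces_def invertible_op_def)
qed

end

text \<open>The section embeds the quotient into \<open>V\<close>, and the coset map is the
  retraction.\<close>

lemma (in nspace_quotient) banach_retract_quotient:
  assumes "banach_retract t V" and s: "s \<in> bounded_ops Q V" "\<And>S. S \<in> carr Q \<Longrightarrow> coset V U (s S) = S"
  shows "banach_retract t Q"
  using banach_retract_trans[OF assms(1) normed_nspace_quotient s(1) coset_bounded_op s(2)] by blast

text \<open>Supplies the projection onto the range of \<open>J\<close> that
  \<open>quotient_section\<close> asks for.\<close>

lemma left_inverse_projection: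
  assumes "normed_nspace V" "normed_nspace W"
    and J: "J \<in> bounded_ops V W" and L: "L \<in> bounded_ops W V" and LJ: "\<forall>x\<in>carr V. L (J x) = x"
  shows "(\<lambda>y. J (L y)) \<in> bounded_ops W W" "range_set W (\<lambda>y. J (L y)) = range_set V J"
    "\<And>y. y \<in> range_set V J \<Longrightarrow> J (L y) = y"
proof -
  show "(\<lambda>y. J (L y)) \<in> bounded_ops W W" by (rule bounded_ops_compose[OF assms(2,1,2) L J])
  show 1: "J (L y) = y" if "y \<in> range_set V J" for y using that LJ by (auto simp: range_set_def)
  show "range_set W (\<lambda>y. J (L y)) = range_set V J"
  proof (intro equalityI subsetI)
    fix y assume y: "y \<in> range_set V J"
    then have "y \<in> carr W" using bounded_opsD(1)[OF J] by (auto simp: range_set_def)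
    with 1[OF y] show "y \<in> range_set W (\<lambda>y. J (L y))" unfolding range_set_def by (metis image_eqI)
  qed (use bounded_opsD(1)[OF L] in \<open>auto simp: range_set_def\<close>)
qed

section \<open>Construction of an invertible completion\<close>

context triangular_operator
begin

text \<open>Every complement is made concrete by a bounded section or left inverse.
  \<open>D\<close>, \<open>E\<close> and \<open>F\<close> are composed of these, and kernel and
  range of the matrix are then computed by hand.\<close>

lemma invertible_upper_triangular_completion:
  assumes A_li: "left_invertible_op X X A" and C_ri: "right_invertible_op Z Z C"
    and J1: "left_invertible_op NB XA J1" and J2: "left_invertible_op YB NC J2"
    and iso: "quotient_space XA (range_set NB J1) \<cong>\<^sub>B quotient_space NC (range_set YB J2)"
  shows "\<exists>D\<in>bounded_ops Y X. \<exists>E\<in>bounded_ops Z X. \<exists>F\<in>bounded_ops Z Y.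
    invertible_op XYZ XYZ (upper_triangular A B C D E F)"
proof -
  have cA: "closed_subspace X (range_set X A)" and cJ1: "closed_subspace XA (range_set NB J1)"
    and cJ2: "closed_subspace NC (range_set YB J2)"
    using A_li J1 J2 by (simp_all add: left_invertible_op_def closed_complemented_def)
  interpret XA: nspace_quotient X "range_set X A"
    using nX cA by (simp add: nspace_quotient_def nspace_quotient_axioms_def)
  note nXA = XA.normed_nspace_quotient and nYB = YB.normed_nspace_quotient
  interpret XJ: nspace_quotient XA "range_set NB J1"
    using nXA cJ1 by (simp add: nspace_quotient_def nspace_quotient_axioms_def)
  interpret CJ: nspace_quotient NC "range_set YB J2"
    using nNC cJ2 by (simp add: nspace_quotient_def nspace_quotient_axioms_def)
  note nXJ = XJ.normed_nspace_quotient and nCJ = CJ.normed_nspace_quotient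
  let ?cA = "coset X (range_set X A)" and ?cB = "coset Y (range_set Y B)"
    and ?c1 = "coset XA (range_set NB J1)" and ?c2 = "coset NC (range_set YB J2)"
  have J1b: "J1 \<in> bounded_ops NB XA" and J2b: "J2 \<in> bounded_ops YB NC"
    using J1 J2 by (simp_all add: left_invertible_op_def)

  obtain PC where PC0: "PC \<in> bounded_ops Z Z" "range PC \<subseteq> null_set Z Z C" "\<forall>z\<in>null_set Z Z C. PC z = z"
    using closed_complemented_imp_projection[OF sZ, of "null_set Z Z C"] C_ri
    by (auto simp: right_invertible_op_def)
  then have PC: "PC \<in> bounded_ops Z NC" "\<And>z. C (PC z) = 0" "\<And>z. C z = 0 \<Longrightarrow> PC z = z"
    by (auto simp: bounded_ops_sub_space_iff null_set_def)

  \<comment> \<open>Bounded inverses are available between retracts of Banach spaces, so each null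
    space and each iterated quotient is shown to be one.\<close>
  have rX: "banach_retract sX X" and rY: "banach_retract sY Y" and rZ: "banach_retract sZ Z"
    by (simp_all add: banach_retract_whole_space sX sY sZ)
  have rNB: "banach_retract sY NB"
    by (rule banach_retract_trans[OF rY nNB NB_incl P_op]) (simp add: NB_simps P_fixed)
  have rNC: "banach_retract sZ NC"
    by (rule banach_retract_trans[OF rZ nNC NC_incl PC(1)]) (simp add: NC_simps PC(3))

  obtain A' where A': "A' \<in> bounded_ops X X" "\<forall>x\<in>carr X. A' (A x) = x"
    using left_invertible_left_inverse[OF rX rX A_li] by blast
  obtain tA where tA: "tA \<in> bounded_ops XA X" "\<And>x. tA (?cA x) = x - A (A' x)"
    "\<And>S. S \<in> carr XA \<Longrightarrow> ?cA (tA S) = S"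
    using XA.quotient_section[OF left_inverse_projection[OF nX nX A A']]
    by (auto simp: banach_scalingD[OF sX])
  obtain tB where tB: "tB \<in> bounded_ops YB Y" "\<And>y. tB (?cB y) = y - B (B' y)"
    "\<And>S. S \<in> carr YB \<Longrightarrow> ?cB (tB S) = S" "\<And>S. S \<in> carr YB \<Longrightarrow> B (B' (tB S)) = 0"
  proof -
    have "\<And>u. u \<in> range_set Y B \<Longrightarrow> B (B' u) = u" by (auto simp: mem_range BB'B)
    from YB.quotient_section[OF BB'_op range_BB' this] show ?thesis
      using that by (auto simp: banach_scalingD[OF sY])
  qed
  have rXA: "banach_retract sX XA" by (rule XA.banach_retract_quotient[OF rX tA(1,3)])
  have rYB: "banach_retract sY YB" by (rule YB.banach_retract_quotient[OF rY tB(1,3)])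
  obtain J1' where J1': "J1' \<in> bounded_ops XA NB" "\<forall>y\<in>carr NB. J1' (J1 y) = y"
    using left_invertible_left_inverse[OF rNB rXA J1] by blast
  obtain J2' where J2': "J2' \<in> bounded_ops NC YB" "\<forall>S\<in>carr YB. J2' (J2 S) = S"
    using left_invertible_left_inverse[OF rYB rNC J2] by blast
  \<comment> \<open>\<open>t1\<close> lifts the quotient by the range of \<open>J1\<close> back to
    X/R(A), with values killed by J1 J1'; \<open>t2\<close> does the same in N(C).\<close>
  obtain t1 where t1: "t1 \<in> bounded_ops XJ.Q XA" "\<forall>u\<in>carr XA. t1 (?c1 u) = XJ.vsub u (J1 (J1' u))"
    "\<forall>S\<in>carr XJ.Q. ?c1 (t1 S) = S \<and> J1 (J1' (t1 S)) = vzero XA"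
    using XJ.quotient_section[OF left_inverse_projection[OF nNB nXA J1b J1']] by blast
  obtain t2 where t2: "t2 \<in> bounded_ops CJ.Q NC" "\<forall>z\<in>carr NC. t2 (?c2 z) = CJ.vsub z (J2 (J2' z))"
    "\<forall>S\<in>carr CJ.Q. ?c2 (t2 S) = S \<and> J2 (J2' (t2 S)) = vzero NC"
    using CJ.quotient_section[OF left_inverse_projection[OF nYB nNC J2b J2']] by blast
  have rXJ: "banach_retract sX XJ.Q"
    by (rule XJ.banach_retract_quotient[OF rXA t1(1)]) (use t1(3) in blast)
  have rCJ: "banach_retract sZ CJ.Q"
    by (rule CJ.banach_retract_quotient[OF rNC t2(1)]) (use t2(3) in blast)
  obtain T T' where T: "T \<in> bounded_ops XJ.Q CJ.Q" and T': "T' \<in> bounded_ops CJ.Q XJ.Q"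
    "\<forall>v\<in>carr XJ.Q. T' (T v) = v" "\<forall>w\<in>carr CJ.Q. T (T' w) = w"
  proof -
    obtain T where T: "invertible_op XJ.Q CJ.Q T" using iso unfolding isomorphic_spaces_def by blast
    from invertible_op_inverse[OF rXJ rCJ this] show ?thesis
      using that T unfolding invertible_op_def by blast
  qed

  \<comment> \<open>\<open>D\<close> carries N(B) through \<open>J1\<close> to a complement of R(A).
    On N(C), \<open>F\<close> carries the copy of Y/R(B) to a complement of R(B), and
    \<open>E\<close> carries the rest, through the inverse \<open>T'\<close>, to the part of X/R(A)
    that \<open>J1\<close> leaves out.\<close>
  define D where "D y = tA (J1 (P y))" for y
  define E where "E z = tA (t1 (T' (?c2 (PC z))))" for z
  define F where "F z = tB (J2' (PC z))" for z
  have D: "D \<in> bounded_ops Y X"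
    unfolding D_def[abs_def]
    by (rule bounded_ops_compose[OF nY nXA nX bounded_ops_compose[OF nY nNB nXA P_op J1b] tA(1)])
  have E: "E \<in> bounded_ops Z X"
    unfolding E_def[abs_def]
    by (rule bounded_ops_compose[OF nZ nXA nX bounded_ops_compose[OF nZ nXJ nXA
          bounded_ops_compose[OF nZ nCJ nXJ bounded_ops_compose[OF nZ nNC nCJ PC(1) CJ.coset_bounded_op]
            T'(1)] t1(1)] tA(1)])
  have F: "F \<in> bounded_ops Z Y"
    unfolding F_def[abs_def]
    by (rule bounded_ops_compose[OF nZ nYB nY bounded_ops_compose[OF nZ nNC nYB PC(1) J2'(1)] tB(1)])
  let ?M = "upper_triangular A B C D E F"
  have M: "?M \<in> bounded_ops XYZ XYZ" by (rule upper_triangular_op[OF D E F])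

  interpret oJ1: normed_nspace_pair NB XA using nNB nXA by (simp add: normed_nspace_pair_def)
  interpret oJ1': normed_nspace_pair XA NB using nNB nXA by (simp add: normed_nspace_pair_def)
  interpret oJ2: normed_nspace_pair YB NC using nNC nYB by (simp add: normed_nspace_pair_def)
  interpret oJ2': normed_nspace_pair NC YB using nNC nYB by (simp add: normed_nspace_pair_def)
  interpret oc1: normed_nspace_pair XA XJ.Q using nXA nXJ by (simp add: normed_nspace_pair_def)
  interpret ot1: normed_nspace_pair XJ.Q XA using nXA nXJ by (simp add: normed_nspace_pair_def)
  interpret oT: normed_nspace_pair XJ.Q CJ.Q using nCJ nXJ by (simp add: normed_nspace_pair_def)
  note lin = A_simps B_simps B'_simps C_simps op_simps[OF A'(1) sX sX]
    op_simps[OF D sY sX] op_simps[OF E sZ sX] op_simps[OF F sZ sY] op_simps[OF PC0(1) sZ sZ]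
  note cXA = bounded_opsD(1)[OF XA.coset_bounded_op, simplified]
  note cYB = bounded_opsD(1)[OF YB.coset_bounded_op, simplified]
  have J1'_t1: "J1' (t1 v) = 0" if v: "v \<in> carr XJ.Q" for v
  proof -
    have "J1' (t1 v) \<in> carr NB" by (intro bounded_opsD(1)[OF J1'(1)] bounded_opsD(1)[OF t1(1)] v)
    then have "J1' (t1 v) = J1' (J1 (J1' (t1 v)))" using J1'(2) by simp
    also have "\<dots> = 0" using t1(3) v oJ1'.op_zero[OF J1'(1)] by (simp add: NB_simps)
    finally show ?thesis .
  qed
  have J2'_t2: "J2' (t2 w) = vzero YB" if w: "w \<in> carr CJ.Q" for w
  proof -
    have "J2' (t2 w) \<in> carr YB" by (intro bounded_opsD(1)[OF J2'(1)] bounded_opsD(1)[OF t2(1)] w)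
    then have "J2' (t2 w) = J2' (J2 (J2' (t2 w)))" using J2'(2) by simp
    also have "\<dots> = vzero YB" using t2(3) w oJ2'.op_zero[OF J2'(1)] by simp
    finally show ?thesis .
  qed

  have kernel: "x = 0 \<and> y = 0 \<and> z = 0"
    if 1: "A x + D y + E z = 0" and 2: "B y + F z = 0" and 3: "C z = 0" for x y z
  proof -
    have zN: "z \<in> carr NC" using 3 by (simp add: NC_simps)
    have Fz: "F z = tB (J2' z)" and Jz: "J2' z \<in> carr YB"
      using bounded_opsD(1)[OF J2'(1) zN] by (simp_all add: F_def PC(3)[OF 3])
    \<comment> \<open>B B' fixes R(B) and kills the values of \<open>tB\<close>. It separates the
      two summands of the second row, so both vanish.\<close>
    have "B (B' (B y + F z)) = B y" using tB(4)[OF Jz] by (simp add: lin BB'B Fz)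
    then have By: "B y = 0" using 2 by (simp add: lin)
    then have "tB (J2' z) = 0" using 2 Fz by simp
    then have J2z: "J2' z = vzero YB" using tB(3)[OF Jz] by (simp add: quotient_space_def)
    have yN: "y \<in> carr NB" using By by (simp add: NB_simps)
    define w where "w = T' (?c2 z)"
    have c2z: "?c2 z \<in> carr CJ.Q" by (rule bounded_opsD(1)[OF CJ.coset_bounded_op zN])
    have wc: "w \<in> carr XJ.Q" unfolding w_def by (rule bounded_opsD(1)[OF T'(1) c2z])
    have J1y: "J1 y \<in> carr XA" and t1w: "t1 w \<in> carr XA"
      using bounded_opsD(1)[OF J1b yN] bounded_opsD(1)[OF t1(1) wc] by simp_all
    have sc: "vadd XA (J1 y) (t1 w) \<in> carr XA" by (rule XJ.add_closed[OF J1y t1w])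
    have DE: "D y + E z = tA (vadd XA (J1 y) (t1 w))"
      using bounded_opsD(2)[OF tA(1) J1y t1w] by (simp add: D_def E_def P_fixed[OF By] PC(3)[OF 3] w_def)
    have "tA (vadd XA (J1 y) (t1 w)) = A (- x)" using 1 DE by (simp add: lin algebra_simps eq_neg_iff_add_eq_0)
    then have "?cA (tA (vadd XA (J1 y) (t1 w))) = vzero XA"
      using XA.coset_eq_zero_iff by (auto simp: mem_range)
    then have s0: "vadd XA (J1 y) (t1 w) = vzero XA" using tA(3)[OF sc] by simp
    \<comment> \<open>\<open>J1'\<close> inverts \<open>J1\<close> and kills the values of
      \<open>t1\<close>, so it isolates y. What remains is t1 w = 0, which puts z into the range of
      \<open>J2\<close>; together with J2' z = 0 this gives z = 0.\<close>
    have "J1' (vadd XA (J1 y) (t1 w)) = y"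
      using bounded_opsD(2)[OF J1'(1) J1y t1w] J1'(2) yN J1'_t1[OF wc] by (simp add: NB_simps)
    then have y0: "y = 0" using s0 oJ1'.op_zero[OF J1'(1)] by (simp add: NB_simps)
    then have "t1 w = vzero XA"
      using s0 oJ1.op_zero[OF J1b] XJ.add_zero_left[OF t1w] by (simp add: NB_simps)
    then have "w = vzero XJ.Q" using t1(3) wc oc1.op_zero[OF XJ.coset_bounded_op] by metis
    then have "?c2 z = vzero CJ.Q" using T'(3) c2z oT.op_zero[OF T] unfolding w_def by metis
    then have "z \<in> range_set YB J2" using CJ.coset_eq_zero_iff[OF zN] by simp
    then obtain S where "S \<in> carr YB" "z = J2 S" by (auto simp: range_set_def)
    then have "z = J2 (vzero YB)" using J2z J2'(2) by simp
    then have z0: "z = 0" using oJ2.op_zero[OF J2b] by (simp add: NC_simps)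
    have "A x = 0" using 1 y0 z0 by (simp add: lin)
    then have "x = A' 0" using A'(2) by (metis UNIV_I whole_space_simps(1))
    then show ?thesis using y0 z0 by (simp add: lin)
  qed

  have surj: "\<exists>x y z. A x + D y + E z = a \<and> B y + F z = b \<and> C z = c" for a b c
  proof -
    obtain z0 where z0: "C z0 = c"
      using C_ri by (auto simp: right_invertible_op_def range_set_def) (metis surjD)
    define u where "u = ?cA a"
    have u: "u \<in> carr XA" unfolding u_def by (rule cXA)
    define y1 where "y1 = J1' u"
    have y1N: "y1 \<in> carr NB" unfolding y1_def by (rule bounded_opsD(1)[OF J1'(1) u])
    have c1u: "?c1 u \<in> carr XJ.Q" by (rule bounded_opsD(1)[OF XJ.coset_bounded_op u])
    have Tc: "T (?c1 u) \<in> carr CJ.Q" by (rule bounded_opsD(1)[OF T c1u])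
    \<comment> \<open>\<open>z2\<close> produces the part of b outside R(B), and \<open>z3\<close>
      the part of a that is left modulo R(A) and the range of \<open>J1\<close>.\<close>
    define z2 where "z2 = J2 (?cB b)"
    define z3 where "z3 = t2 (T (?c1 u))"
    have z2N: "z2 \<in> carr NC" unfolding z2_def by (rule bounded_opsD(1)[OF J2b cYB])
    have z3N: "z3 \<in> carr NC" unfolding z3_def by (rule bounded_opsD(1)[OF t2(1) Tc])
    define x where "x = A' a"
    \<comment> \<open>B' B B' b has the same image under \<open>B\<close> as B' b, but
      \<open>P\<close> kills it, so that P y = y1 and \<open>D\<close> sees \<open>y1\<close>
      alone.\<close>
    define y where "y = B' (B (B' b)) + y1"
    \<comment> \<open>Subtracting PC z0 keeps the value c under \<open>C\<close> and makes the first
      summand invisible to \<open>PC\<close>, hence to \<open>E\<close> and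
      \<open>F\<close>.\<close>
    define z where "z = (z0 - PC z0) + (z2 + z3)"
    have Cz: "C z = c" using z2N z3N by (simp add: z_def lin z0 PC(2) NC_simps)
    have PCz: "PC z = vadd NC z2 z3"
      using z2N z3N by (simp add: z_def lin PC NC_simps)
    have Jc: "J2' z2 = ?cB b" unfolding z2_def using J2'(2) cYB by blast
    have "J2' (PC z) = vadd YB (?cB b) (vzero YB)"
      unfolding PCz bounded_opsD(2)[OF J2'(1) z2N z3N] Jc unfolding z3_def J2'_t2[OF Tc] ..
    then have "F z = b - B (B' b)" using oJ2.V.add_zero_right[OF cYB] by (simp add: F_def tB(2))
    moreover have "B y = B (B' b)" using y1N by (simp add: y_def lin BB'B NB_simps)
    ultimately have 2: "B y + F z = b" by simp
    have "P y = y1" using y1N by (simp add: P_def y_def lin BB'B NB_simps)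
    then have Dy: "D y = tA (J1 y1)" by (simp add: D_def)
    have "?c2 z2 = vzero CJ.Q" using CJ.coset_eq_zero_iff[OF z2N] cYB by (auto simp: z2_def range_set_def)
    moreover have "?c2 z3 = T (?c1 u)" unfolding z3_def using t2(3) Tc by blast
    ultimately have "?c2 (PC z) = T (?c1 u)"
      unfolding PCz bounded_opsD(2)[OF CJ.coset_bounded_op z2N z3N] by (simp add: oT.W.add_zero_left[OF Tc])
    then have Ez: "E z = tA (t1 (?c1 u))" using T'(2) c1u by (simp add: E_def)
    have J1y: "J1 y1 \<in> carr XA" by (rule bounded_opsD(1)[OF J1b y1N])
    have t1u: "t1 (?c1 u) \<in> carr XA" by (rule bounded_opsD(1)[OF t1(1) c1u])
    have "D y + E z = tA (vadd XA (t1 (?c1 u)) (J1 y1))"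
      unfolding Dy Ez using bounded_opsD(2)[OF tA(1) t1u J1y] by (simp add: add.commute)
    \<comment> \<open>The splitting of X/R(A) by the projection J1 J1': the lift of the class of u
      is u - J1 J1' u, and y1 = J1' u.\<close>
    also have "vadd XA (t1 (?c1 u)) (J1 y1) = u"
      using t1(2) u XJ.sub_add[OF u J1y] by (simp add: y1_def)
    also have "tA u = a - A x" by (simp add: u_def tA(2) x_def)
    finally have "A x + D y + E z = a" by (simp add: add.assoc)
    then show ?thesis using 2 Cz by blast
  qed

  have M_apply: "?M (x, y, z) = (A x + D y + E z, B y + F z, C z)" for x y z
    by (simp add: upper_triangular_def)
  have "inj ?M"
  proof (rule injI)
    fix p q assume "?M p = ?M q"
    then have "?M (p - q) = 0" using op_simps(2)[OF M sXYZ sXYZ, of p q] by simp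
    then have "p - q = 0"
      using kernel[of "fst (p - q)" "fst (snd (p - q))" "snd (snd (p - q))"]
      by (cases "p - q") (simp add: M_apply zero_prod_def)
    then show "p = q" by simp
  qed
  moreover have "surj ?M"
  unfolding surj_def
  proof (rule allI)
    fix q :: "'x \<times> 'y \<times> 'z"
    obtain x y z where "A x + D y + E z = fst q \<and> B y + F z = fst (snd q) \<and> C z = snd (snd q)"
      using surj by blast
    then have "?M (x, y, z) = q" by (simp add: M_apply)
    then show "\<exists>p. q = ?M p" by metis
  qed
  ultimately have "invertible_op XYZ XYZ ?M" using M by (simp add: invertible_op_def bij_def)
  then show ?thesis using D E F by blast
qed

end

text \<open>Regularity supplies the inner inverse with which \<open>triangular_operator\<close> is
  instantiated, and \<open>T.XYZ\<close> turns the iterated product into the whole space used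
  there.\<close>

theorem theorem2p1:
  fixes sX :: "'k::real_normed_field \<Rightarrow> 'x::banach \<Rightarrow> 'x"
    and sY :: "'k \<Rightarrow> 'y::banach \<Rightarrow> 'y"
    and sZ :: "'k \<Rightarrow> 'z::banach \<Rightarrow> 'z"
    and X :: "('k, 'x) nspace" and Y :: "('k, 'y) nspace" and Z :: "('k, 'z) nspace"
    and A :: "'x \<Rightarrow> 'x" and B :: "'y \<Rightarrow> 'y" and C :: "'z \<Rightarrow> 'z"
    and NB :: "('k, 'y) nspace" and NC :: "('k, 'z) nspace"
    and XA :: "('k, 'x set) nspace" and YB :: "('k, 'y set) nspace"
  assumes "banach_scaling sX" and "banach_scaling sY" and "banach_scaling sZ"
  defines "X \<equiv> whole_space sX" and "Y \<equiv> whole_space sY" and "Z \<equiv> whole_space sZ"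
  assumes "A \<in> bounded_ops X X" and "B \<in> bounded_ops Y Y" and "C \<in> bounded_ops Z Z"
    and "regular_op Y Y B"
  defines "NB \<equiv> sub_space Y (null_set Y Y B)" and "NC \<equiv> sub_space Z (null_set Z Z C)"
    and "XA \<equiv> quotient_space X (range_set X A)" and "YB \<equiv> quotient_space Y (range_set Y B)"
  defines "S1 \<equiv>
      (left_invertible_op X X A \<and> right_invertible_op Z Z C) \<and>
      (NB \<preceq>\<^sub>B XA \<and> YB \<preceq>\<^sub>B NC) \<and>
      (\<exists>J1 J2. left_invertible_op NB XA J1 \<and> left_invertible_op YB NC J2 \<and>
         quotient_space XA (range_set NB J1) \<cong>\<^sub>B quotient_space NC (range_set YB J2))"
    and "S2 \<equiv>
      (\<exists>D\<in>bounded_ops Y X. \<exists>E\<in>bounded_ops Z X. \<exists>F\<in>bounded_ops Z Y.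
         invertible_op (prod_space X (prod_space Y Z)) (prod_space X (prod_space Y Z))
           (upper_triangular A B C D E F))"
    and "S3 \<equiv>
      (left_invertible_op X X A \<and> right_invertible_op Z Z C) \<and>
      (NB \<preceq>\<^sub>B XA \<and> YB \<preceq>\<^sub>B NC) \<and>
      prod_space NB NC \<cong>\<^sub>B prod_space XA YB"
  shows "(S1 \<longrightarrow> S2) \<and> (S2 \<longrightarrow> S3)"
proof -
  note ops = \<open>A \<in> bounded_ops X X\<close> \<open>B \<in> bounded_ops Y Y\<close> \<open>C \<in> bounded_ops Z Z\<close>
  obtain B' where B': "B' \<in> bounded_ops Y Y" "\<forall>y\<in>carr Y. B y = B (B' (B y))"
    using \<open>regular_op Y Y B\<close> unfolding regular_op_def by blast
  interpret T: triangular_operator sX sY sZ A B B' C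
  proof
    show "B (B' (B y)) = B y" for y using B'(2) by (simp add: Y_def)
  qed (use assms(1-3) ops B'(1) in \<open>simp_all only: X_def Y_def Z_def\<close>)
  have "S2" if "S1"
  proof -
    obtain J1 J2 where "left_invertible_op NB XA J1" "left_invertible_op YB NC J2"
      "quotient_space XA (range_set NB J1) \<cong>\<^sub>B quotient_space NC (range_set YB J2)"
      "left_invertible_op X X A" "right_invertible_op Z Z C"
      using \<open>S1\<close> unfolding S1_def by blast
    then show ?thesis
      unfolding S2_def NB_def NC_def XA_def YB_def X_def Y_def Z_def T.XYZ by (intro T.invertible_upper_triangular_completion)
  qed
  moreover have "S3" if "S2"
  proof -
    obtain D E F where "D \<in> bounded_ops Y X" "E \<in> bounded_ops Z X" "F \<in> bounded_ops Z Y"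
      "invertible_op (prod_space X (prod_space Y Z)) (prod_space X (prod_space Y Z))
        (upper_triangular A B C D E F)"
      using \<open>S2\<close> unfolding S2_def by blast
    from T.invertible_upper_triangular_imp[OF this[unfolded X_def Y_def Z_def T.XYZ]] show ?thesis
      unfolding S3_def NB_def NC_def XA_def YB_def X_def Y_def Z_def by (intro conjI)
  qed
  ultimately show ?thesis by blast
qed

end
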